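(* Let $K$ be a field, $n\ge1$, and let $\mathbb{S}_n$ be the algebra of one-sided inverses with its involution $\eta$. Then: 1. $Q'(\mathbb{S}_n)\simeq \eta({}'Q(\mathbb{S}_n))= K(x_1,\ldots,x_n)$, the field of rational functions in $n$ variables. 2. $\mathcal{C}'_{\mathbb{S}_n}=S'(\mathbb{S}_n)$ and $Q'_{r,cl}(\mathbb{S}_n)=Q'(\mathbb{S}_n)\simeq K(x_1,\ldots,x_n)$.
   Context: All rings are unital. A subset $S$ of a ring $R$ is multiplicative if $1\in S$, $SS\subseteq S$, $0\notin S$. A multiplicative set $S$ is a left Ore set if $Sr\cap Rs\neq\emptyset$ for all $r\in R$, $s\in S$; it is a left denominator set if moreover $rs=0$ ($r\in R,s\in S$) implies $tr=0$ for some $t\in S$; $S^{-1}R$ is the left localization. Right Ore sets, right denominator sets and right localizations $RS^{-1}$ are defined symmetrically. ${}'\mathcal{C}_R=\{c\in R\mid rc=0\Rightarrow r=0\}$ and $\mathcal{C}'_R=\{c\in R\mid cr=0\Rightarrow r=0\}$ are the sets of left, respectively right, regular elements. ${}'S(R)$ is the largest left denominator set of $R$ contained in ${}'\mathcal{C}_R$ (it exists) and ${}'Q(R):={}'S(R)^{-1}R$. $S'(R)$ is the largest right denominator set of $R$ contained in $\mathcal{C}'_R$ (it exists) and $Q'(R):=R\,S'(R)^{-1}$ is the right regular right quotient ring. If $\mathcal{C}'_R$ is itself a right denominator set, then $Q'_{r,cl}(R):=R\,\mathcal{C}_R'^{-1}$; a statement about $Q'_{r,cl}(R)$ includes the assertion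 that it exists. The symbol $\simeq$ denotes isomorphism of $K$-algebras. $\mathbb{S}_n$ is the $K$-algebra generated by $x_1,\ldots,x_n,y_1,\ldots,y_n$ subject to the relations $y_ix_i=1$ for all $i$ and $[x_i,y_j]=[x_i,x_j]=[y_i,y_j]=0$ for all $i\ne j$. The involution $\eta:\mathbb{S}_n\to\mathbb{S}_n$ is the $K$-algebra anti-automorphism with $\eta(x_i)=y_i$, $\eta(y_i)=x_i$; $\eta({}'Q(\mathbb{S}_n))$ denotes the ring obtained from ${}'Q(\mathbb{S}_n)$ by transport along $\eta$, i.e. the right localization of $\mathbb{S}_n$ at $\eta({}'S(\mathbb{S}_n))$. *)

theory Defs
  imports
    "HOL-Algebra.QuotRing"
    "HOL-Algebra.Module"
    "HOL-Library.Poly_Mapping"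
    "HOL-Computational_Algebra.Fraction_Field"
begin

section \<open>Regular elements, denominator sets and right localization\<close>

definition left_regular :: "('a, 'm) ring_scheme \<Rightarrow> 'a set" where
  "left_regular R =
     {c \<in> carrier R. \<forall>r \<in> carrier R. r \<otimes>\<^bsub>R\<^esub> c = \<zero>\<^bsub>R\<^esub> \<longrightarrow> r = \<zero>\<^bsub>R\<^esub>}"

definition right_regular :: "('a, 'm) ring_scheme \<Rightarrow> 'a set" where
  "right_regular R =
     {c \<in> carrier R. \<forall>r \<in> carrier R. c \<otimes>\<^bsub>R\<^esub> r = \<zero>\<^bsub>R\<^esub> \<longrightarrow> r = \<zero>\<^bsub>R\<^esub>}"

definition multiplicative_set :: "('a, 'm) ring_scheme \<Rightarrow> 'a set \<Rightarrow> bool" where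
  "multiplicative_set R S \<longleftrightarrow>
     S \<subseteq> carrier R \<and> \<one>\<^bsub>R\<^esub> \<in> S \<and> (\<forall>s \<in> S. \<forall>t \<in> S. s \<otimes>\<^bsub>R\<^esub> t \<in> S) \<and> \<zero>\<^bsub>R\<^esub> \<notin> S"

definition left_Ore_set :: "('a, 'm) ring_scheme \<Rightarrow> 'a set \<Rightarrow> bool" where
  "left_Ore_set R S \<longleftrightarrow> multiplicative_set R S \<and>
     (\<forall>r \<in> carrier R. \<forall>s \<in> S.
        (\<lambda>t. t \<otimes>\<^bsub>R\<^esub> r) ` S \<inter> (\<lambda>q. q \<otimes>\<^bsub>R\<^esub> s) ` carrier R \<noteq> {})"

definition right_Ore_set :: "('a, 'm) ring_scheme \<Rightarrow> 'a set \<Rightarrow> bool" where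
  "right_Ore_set R S \<longleftrightarrow> multiplicative_set R S \<and>
     (\<forall>r \<in> carrier R. \<forall>s \<in> S.
        (\<lambda>t. r \<otimes>\<^bsub>R\<^esub> t) ` S \<inter> (\<lambda>q. s \<otimes>\<^bsub>R\<^esub> q) ` carrier R \<noteq> {})"

definition left_denominator_set :: "('a, 'm) ring_scheme \<Rightarrow> 'a set \<Rightarrow> bool" where
  "left_denominator_set R S \<longleftrightarrow> left_Ore_set R S \<and>
     (\<forall>r \<in> carrier R. \<forall>s \<in> S.
        r \<otimes>\<^bsub>R\<^esub> s = \<zero>\<^bsub>R\<^esub> \<longrightarrow> (\<exists>t \<in> S. t \<otimes>\<^bsub>R\<^esub> r = \<zero>\<^bsub>R\<^esub>))"

definition right_denominator_set :: "('a, 'm) ring_scheme \<Rightarrow> 'a set \<Rightarrow> bool" where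
  "right_denominator_set R S \<longleftrightarrow> right_Ore_set R S \<and>
     (\<forall>r \<in> carrier R. \<forall>s \<in> S.
        s \<otimes>\<^bsub>R\<^esub> r = \<zero>\<^bsub>R\<^esub> \<longrightarrow> (\<exists>t \<in> S. r \<otimes>\<^bsub>R\<^esub> t = \<zero>\<^bsub>R\<^esub>))"

text \<open>A pair \<open>(r, s)\<close> stands for the right fraction \<open>r s\<^sup>-\<^sup>1\<close>; two fractions are identified when
  they can be brought to one numerator over one denominator in \<open>S\<close>.\<close>

definition right_frac_rel ::
    "('a, 'm) ring_scheme \<Rightarrow> 'a set \<Rightarrow> (('a \<times> 'a) \<times> ('a \<times> 'a)) set" where
  "right_frac_rel R S =
     {((r, s), (r', s')). r \<in> carrier R \<and> s \<in> S \<and> r' \<in> carrier R \<and> s' \<in> S \<and>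
        (\<exists>u \<in> carrier R. \<exists>v \<in> carrier R.
           r \<otimes>\<^bsub>R\<^esub> u = r' \<otimes>\<^bsub>R\<^esub> v \<and> s \<otimes>\<^bsub>R\<^esub> u = s' \<otimes>\<^bsub>R\<^esub> v \<and> s \<otimes>\<^bsub>R\<^esub> u \<in> S)}"

definition right_frac ::
    "('a, 'm) ring_scheme \<Rightarrow> 'a set \<Rightarrow> 'a \<Rightarrow> 'a \<Rightarrow> ('a \<times> 'a) set" where
  "right_frac R S r s = right_frac_rel R S `` {(r, s)}"

text \<open>The right localization \<open>R S\<^sup>-\<^sup>1\<close> at a right denominator set \<open>S\<close>, as an algebra when \<open>R\<close> is one.
  As with the operations of \<^const>\<open>FactRing\<close>, an operation on classes is the union of its results
  on all representatives, all of which are the same class: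
  \<open>r\<^sub>1 s\<^sub>1\<^sup>-\<^sup>1 r\<^sub>2 s\<^sub>2\<^sup>-\<^sup>1 = r\<^sub>1 u (s\<^sub>2 t)\<^sup>-\<^sup>1\<close> if \<open>s\<^sub>1 u = r\<^sub>2 t\<close> with \<open>t \<in> S\<close>, and
  \<open>r\<^sub>1 s\<^sub>1\<^sup>-\<^sup>1 + r\<^sub>2 s\<^sub>2\<^sup>-\<^sup>1 = (r\<^sub>1 u + r\<^sub>2 v) (s\<^sub>1 u)\<^sup>-\<^sup>1\<close> if \<open>s\<^sub>1 u = s\<^sub>2 v \<in> S\<close>.\<close>

definition right_localization ::
    "('k, 'a, 'm) module_scheme \<Rightarrow> 'a set \<Rightarrow> ('k, ('a \<times> 'a) set) module" where
  "right_localization R S =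
     \<lparr>carrier = (carrier R \<times> S) // right_frac_rel R S,
      mult = (\<lambda>A B. \<Union>{right_frac R S (r\<^sub>1 \<otimes>\<^bsub>R\<^esub> u) (s\<^sub>2 \<otimes>\<^bsub>R\<^esub> t) | r\<^sub>1 s\<^sub>1 r\<^sub>2 s\<^sub>2 u t.
         (r\<^sub>1, s\<^sub>1) \<in> A \<and> (r\<^sub>2, s\<^sub>2) \<in> B \<and> u \<in> carrier R \<and> t \<in> S \<and> s\<^sub>1 \<otimes>\<^bsub>R\<^esub> u = r\<^sub>2 \<otimes>\<^bsub>R\<^esub> t}),
      one = right_frac R S \<one>\<^bsub>R\<^esub> \<one>\<^bsub>R\<^esub>,
      zero = right_frac R S \<zero>\<^bsub>R\<^esub> \<one>\<^bsub>R\<^esub>,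
      add = (\<lambda>A B. \<Union>{right_frac R S (r\<^sub>1 \<otimes>\<^bsub>R\<^esub> u \<oplus>\<^bsub>R\<^esub> r\<^sub>2 \<otimes>\<^bsub>R\<^esub> v) (s\<^sub>1 \<otimes>\<^bsub>R\<^esub> u) | r\<^sub>1 s\<^sub>1 r\<^sub>2 s\<^sub>2 u v.
         (r\<^sub>1, s\<^sub>1) \<in> A \<and> (r\<^sub>2, s\<^sub>2) \<in> B \<and> u \<in> carrier R \<and> v \<in> carrier R \<and>
         s\<^sub>1 \<otimes>\<^bsub>R\<^esub> u = s\<^sub>2 \<otimes>\<^bsub>R\<^esub> v \<and> s\<^sub>1 \<otimes>\<^bsub>R\<^esub> u \<in> S}),
      smult = (\<lambda>c A. \<Union>{right_frac R S (c \<odot>\<^bsub>R\<^esub> r) s | r s. (r, s) \<in> A})\<rparr>"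

text \<open>\<open>'S(R)\<close>, \<open>S'(R)\<close>, \<open>Q'(R)\<close> and \<open>Q'\<^bsub>r,cl\<^esub>(R)\<close>; the last is
  meaningful only if \<^term>\<open>right_denominator_set R (right_regular R)\<close>.\<close>

definition largest_left_regular_denom :: "('a, 'm) ring_scheme \<Rightarrow> 'a set" where
  "largest_left_regular_denom R =
     (GREATEST S. left_denominator_set R S \<and> S \<subseteq> left_regular R)"

definition largest_right_regular_denom :: "('a, 'm) ring_scheme \<Rightarrow> 'a set" where
  "largest_right_regular_denom R =
     (GREATEST S. right_denominator_set R S \<and> S \<subseteq> right_regular R)"

definition right_regular_quotient_ring ::
    "('k, 'a, 'm) module_scheme \<Rightarrow> ('k, ('a \<times> 'a) set) module" where
  "right_regular_quotient_ring R = right_localization R (largest_right_regular_denom R)"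

definition classical_right_regular_quotient_ring ::
    "('k, 'a, 'm) module_scheme \<Rightarrow> ('k, ('a \<times> 'a) set) module" where
  "classical_right_regular_quotient_ring R = right_localization R (right_regular R)"


section \<open>Isomorphisms of algebras\<close>

definition algebra_iso ::
    "('k, 'a, 'm) module_scheme \<Rightarrow> ('k, 'b, 'n) module_scheme \<Rightarrow> ('a \<Rightarrow> 'b) set" where
  "algebra_iso A B =
     {h \<in> ring_iso A B. \<forall>c. \<forall>a \<in> carrier A. h (c \<odot>\<^bsub>A\<^esub> a) = c \<odot>\<^bsub>B\<^esub> h a}"

definition algebra_isomorphic ::
    "('k, 'a, 'm) module_scheme \<Rightarrow> ('k, 'b, 'n) module_scheme \<Rightarrow> bool" (infix "\<simeq>\<^sub>a" 50) where
  "A \<simeq>\<^sub>a B \<longleftrightarrow> algebra_iso A B \<noteq> {}"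


section \<open>The algebra of one-sided inverses\<close>

text \<open>The free unital algebra over the field \<open>'k\<close> on a set of letters: finitely supported
  functions on words, with concatenation of words extended bilinearly as product.\<close>

definition free_algebra :: "'g set \<Rightarrow> ('k::field, 'g list \<Rightarrow> 'k) module" where
  "free_algebra G =
     \<lparr>carrier = {f. finite {w. f w \<noteq> 0} \<and> {w. f w \<noteq> 0} \<subseteq> lists G},
      mult = (\<lambda>f g w. \<Sum>i\<le>length w. f (take i w) * g (drop i w)),
      one = (\<lambda>w. if w = [] then 1 else 0),
      zero = (\<lambda>w. 0),
      add = (\<lambda>f g w. f w + g w),
      smult = (\<lambda>c f w. c * f w)\<rparr>"

definition word :: "'g list \<Rightarrow> 'g list \<Rightarrow> 'k::field" where
  "word v = (\<lambda>w. if w = v then 1 else 0)"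

datatype gen = X nat | Y nat

definition gens :: "nat \<Rightarrow> gen set" where
  "gens n = X ` {1..n} \<union> Y ` {1..n}"

definition osi_relators :: "nat \<Rightarrow> (gen list \<Rightarrow> 'k::field) set" where
  "osi_relators n =
     {word [Y i, X i] - word [] | i. i \<in> {1..n}} \<union>
     {word [X i, Y j] - word [Y j, X i] | i j. i \<in> {1..n} \<and> j \<in> {1..n} \<and> i \<noteq> j} \<union>
     {word [X i, X j] - word [X j, X i] | i j. i \<in> {1..n} \<and> j \<in> {1..n} \<and> i \<noteq> j} \<union>
     {word [Y i, Y j] - word [Y j, Y i] | i j. i \<in> {1..n} \<and> j \<in> {1..n} \<and> i \<noteq> j}"

definition osi_ideal :: "nat \<Rightarrow> (gen list \<Rightarrow> 'k::field) set" where
  "osi_ideal n = Idl\<^bsub>free_algebra (gens n)\<^esub> (osi_relators n)"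

text \<open>The algebra \<open>\<bbbS>\<^sub>n\<close>. The argument of type \<open>'k itself\<close> only names the ground field.\<close>

definition osi_algebra ::
    "'k::field itself \<Rightarrow> nat \<Rightarrow> ('k, (gen list \<Rightarrow> 'k) set) module" where
  "osi_algebra K n = ring.extend (free_algebra (gens n) Quot osi_ideal n)
     (module.fields (\<lambda>c A. \<Union>f \<in> A.
        osi_ideal n +>\<^bsub>free_algebra (gens n)\<^esub> (c \<odot>\<^bsub>free_algebra (gens n)\<^esub> f)))"

definition osi_gen :: "'k::field itself \<Rightarrow> nat \<Rightarrow> gen \<Rightarrow> (gen list \<Rightarrow> 'k) set" where
  "osi_gen K n g = osi_ideal n +>\<^bsub>free_algebra (gens n)\<^esub> word [g]"

text \<open>The involution \<open>\<eta>\<close>: on the free algebra it reverses words and exchanges each \<open>x\<^sub>i\<close> with \<open>y\<^sub>i\<close>.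
  This permutes the relators up to sign, so the image of a coset of \<^term>\<open>osi_ideal n\<close>
  is again a coset.\<close>

fun swap_gen :: "gen \<Rightarrow> gen" where
  "swap_gen (X i) = Y i"
| "swap_gen (Y i) = X i"

definition eta :: "(gen list \<Rightarrow> 'k::field) set \<Rightarrow> (gen list \<Rightarrow> 'k) set" where
  "eta A = (\<lambda>f w. f (rev (map swap_gen w))) ` A"

text \<open>\<open>\<eta>('Q(\<bbbS>\<^sub>n))\<close>: transport along \<open>\<eta>\<close> turns a left fraction
  \<open>s\<^sup>-\<^sup>1 r\<close> into the right fraction \<open>\<eta>(r) \<eta>(s)\<^sup>-\<^sup>1\<close>.\<close>

definition eta_denom :: "'k::field itself \<Rightarrow> nat \<Rightarrow> (gen list \<Rightarrow> 'k) set set" where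
  "eta_denom K n = eta ` largest_left_regular_denom (osi_algebra K n)"

definition eta_left_regular_quotient_ring ::
    "'k::field itself \<Rightarrow> nat \<Rightarrow>
       ('k, ((gen list \<Rightarrow> 'k) set \<times> (gen list \<Rightarrow> 'k) set) set) module" where
  "eta_left_regular_quotient_ring K n = right_localization (osi_algebra K n) (eta_denom K n)"


section \<open>Rational functions in n variables\<close>

text \<open>Polynomials in countably many variables are finitely supported functions on exponent vectors;
  \<open>K(x\<^sub>1,\<dots>,x\<^sub>n)\<close> consists of the fractions that have a representative in which only
  \<open>x\<^sub>1,\<dots>,x\<^sub>n\<close> occur.\<close>

type_synonym 'k mpol = "(nat \<Rightarrow>\<^sub>0 nat) \<Rightarrow>\<^sub>0 'k"

definition polys_upto :: "nat \<Rightarrow> 'k::field mpol set" where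
  "polys_upto n = {p. \<forall>m \<in> Poly_Mapping.keys p. Poly_Mapping.keys m \<subseteq> {1..n}}"

definition ratfun_field :: "'k::field itself \<Rightarrow> nat \<Rightarrow> ('k, 'k mpol fract) module" where
  "ratfun_field K n =
     \<lparr>carrier = {Fract p q | p q. p \<in> polys_upto n \<and> q \<in> polys_upto n \<and> q \<noteq> 0},
      mult = (*), one = 1, zero = 0, add = (+),
      smult = (\<lambda>c f. Fract (Poly_Mapping.single 0 c) 1 * f)\<rparr>"

definition ratfun_var :: "'k::field itself \<Rightarrow> nat \<Rightarrow> 'k mpol fract" where
  "ratfun_var K i = Fract (Poly_Mapping.single (Poly_Mapping.single i 1) 1) 1"

end

theory Submission
  imports Defs "HOL-Library.Multiset"
begin

text \<open>
  Let \<open>P = K[x\<^sub>1,\<dots>,x\<^sub>n]\<close> inside \<open>\<bbbS>\<^sub>n\<close> and let \<open>\<pi>\<close> be the homomorphism from \<open>\<bbbS>\<^sub>n\<close> to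
  \<open>K(x\<^sub>1,\<dots>,x\<^sub>n)\<close> with \<open>\<pi>(x\<^sub>i) = x\<^sub>i\<close> and \<open>\<pi>(y\<^sub>i) = x\<^sub>i\<^sup>-\<^sup>1\<close>. Since \<open>y\<^sub>i x\<^sub>i = 1\<close>, every \<open>r\<close>
  is carried into \<open>P\<close> by right multiplication with a monomial of \<open>P\<close>. The algebra acts faithfully on
  \<open>K[x\<^sub>1,\<dots>,x\<^sub>n]\<close> with \<open>P\<close> acting by multiplication, so nonzero elements of \<open>P\<close> are right regular.
  Hence a right regular element has nonzero image under \<open>\<pi>\<close>; the right Ore condition follows from
  \<open>r t (s t') = s t' (r t)\<close> with \<open>r t, s t' \<in> P\<close>; and two right fractions agree iff their images in
  the field do. The left hand versions follow by applying \<open>\<eta>\<close>.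
\<close>

section \<open>Right localization at the right regular elements\<close>

text \<open>The obstacle is that \<pi> is not injective: 1 - x_i y_i is a nonzero element of its
  kernel. It satisfies (1 - x_i y_i) x_i = 0, and in the same way every r with \<pi> r = 0 is
  annihilated by the t that carries it into P, because \<pi> is injective on P. So inverting the
  right regular elements on the right kills exactly the kernel of \<pi>. A nonzero image does not
  make an element right regular: y_i goes to a unit, yet y_i (1 - x_i y_i) = 0. Hence the right
  regular elements are never described explicitly; what is used is that they contain the nonzero
  part of P and that \<pi> does not vanish on them. Two representations share the work: on
  K[x_1,...,x_n] the operator of y_i is only a left inverse of that of x_i, this one is faithful and
  decides equality in the algebra; on K(x_1,...,x_n) it is the inverse, and this one yields
  \<pi>.\<close>

lemma right_regularI:
  "c \<in> carrier R \<Longrightarrow> (\<And>r. r \<in> carrier R \<Longrightarrow> c \<otimes>\<^bsub>R\<^esub> r = \<zero>\<^bsub>R\<^esub> \<Longrightarrow> r = \<zero>\<^bsub>R\<^esub>) \<Longrightarrow> c \<in> right_regular R"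
  unfolding right_regular_def by blast

lemma right_regularD:
  assumes "c \<in> right_regular R"
  shows "c \<in> carrier R" "r \<in> carrier R \<Longrightarrow> c \<otimes>\<^bsub>R\<^esub> r = \<zero>\<^bsub>R\<^esub> \<Longrightarrow> r = \<zero>\<^bsub>R\<^esub>"
  using assms unfolding right_regular_def by blast+

lemma multiplicative_set_right_regular:
  assumes "ring R" "\<one>\<^bsub>R\<^esub> \<noteq> \<zero>\<^bsub>R\<^esub>"
  shows "multiplicative_set R (right_regular R)"
proof -
  interpret ring R by fact
  have "s \<otimes>\<^bsub>R\<^esub> t \<in> right_regular R" if s: "s \<in> right_regular R" and t: "t \<in> right_regular R" for s t
  proof (rule right_regularI)
    fix r assume r: "r \<in> carrier R" "(s \<otimes>\<^bsub>R\<^esub> t) \<otimes>\<^bsub>R\<^esub> r = \<zero>\<^bsub>R\<^esub>"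
    then have "s \<otimes>\<^bsub>R\<^esub> (t \<otimes>\<^bsub>R\<^esub> r) = \<zero>\<^bsub>R\<^esub>"
      using right_regularD(1)[OF s] right_regularD(1)[OF t] by (simp add: m_assoc)
    with r(1) have "t \<otimes>\<^bsub>R\<^esub> r = \<zero>\<^bsub>R\<^esub>"
      using right_regularD(2)[OF s, of "t \<otimes>\<^bsub>R\<^esub> r"] right_regularD(1)[OF t] by simp
    with r(1) show "r = \<zero>\<^bsub>R\<^esub>"
      by (rule right_regularD(2)[OF t])
  qed (simp add: right_regularD(1)[OF s] right_regularD(1)[OF t])
  moreover have "\<zero>\<^bsub>R\<^esub> \<notin> right_regular R"
    using right_regularD(2)[of "\<zero>\<^bsub>R\<^esub>" R "\<one>\<^bsub>R\<^esub>"] assms(2) by auto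
  moreover have "\<one>\<^bsub>R\<^esub> \<in> right_regular R"
    by (rule right_regularI) auto
  moreover have "right_regular R \<subseteq> carrier R"
    unfolding right_regular_def by blast
  ultimately show ?thesis
    unfolding multiplicative_set_def by blast
qed

text \<open>All candidates lie in \<open>right_regular R\<close> by definition, so this set is the
  greatest as soon as it is itself a candidate.\<close>

lemma largest_right_regular_denom_eq:
  assumes "right_denominator_set R (right_regular R)"
  shows "largest_right_regular_denom R = right_regular R"
  unfolding largest_right_regular_denom_def by (rule Greatest_equality) (use assms in auto)

lemma largest_left_regular_denom_eq:
  assumes "left_denominator_set R (left_regular R)"
  shows "largest_left_regular_denom R = left_regular R"
  unfolding largest_left_regular_denom_def by (rule Greatest_equality) (use assms in auto)

text \<open>The operations of \<open>right_localization\<close> are unions over representatives.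
  Independence of the representative and the existence of one admissible choice are the two
  premises.\<close>

lemma Union_const: "(\<And>x. x \<in> A \<Longrightarrow> x = c) \<Longrightarrow> A \<noteq> {} \<Longrightarrow> \<Union>A = c"
  by auto

text \<open>Every element of \<open>R\<close> can be moved into the commutative part \<open>P\<close> by a right multiplication,
  so \<open>\<pi>\<close> identifies right fractions with honest fractions in a field.\<close>

locale right_regular_fractions = ring R
  for R :: "('k, 'a, 'm) module_scheme" (structure) +
  fixes \<pi> :: "'a \<Rightarrow> 'f::field" and \<iota> :: "'k \<Rightarrow> 'f" and P :: "'a set"
  assumes hom_mult: "\<lbrakk>a \<in> carrier R; b \<in> carrier R\<rbrakk> \<Longrightarrow> \<pi> (a \<otimes> b) = \<pi> a * \<pi> b"
    and hom_add: "\<lbrakk>a \<in> carrier R; b \<in> carrier R\<rbrakk> \<Longrightarrow> \<pi> (a \<oplus> b) = \<pi> a + \<pi> b"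
    and hom_one: "\<pi> \<one> = 1"
    and smult_closed: "a \<in> carrier R \<Longrightarrow> c \<odot> a \<in> carrier R"
    and hom_smult: "a \<in> carrier R \<Longrightarrow> \<pi> (c \<odot> a) = \<iota> c * \<pi> a"
    and P_carrier: "P \<subseteq> carrier R"
    and P_mult: "\<lbrakk>p \<in> P; q \<in> P\<rbrakk> \<Longrightarrow> p \<otimes> q \<in> P"
    and P_comm: "\<lbrakk>p \<in> P; q \<in> P\<rbrakk> \<Longrightarrow> p \<otimes> q = q \<otimes> p"
    and P_inj: "\<lbrakk>p \<in> P; \<pi> p = 0\<rbrakk> \<Longrightarrow> p = \<zero>"
    and P_regular: "\<lbrakk>p \<in> P; p \<noteq> \<zero>\<rbrakk> \<Longrightarrow> p \<in> right_regular R"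
    and P_denom: "r \<in> carrier R \<Longrightarrow> \<exists>t \<in> P. t \<noteq> \<zero> \<and> r \<otimes> t \<in> P"
begin

section \<open>Torsion, the Ore condition and equality of fractions\<close>

abbreviation "S \<equiv> right_regular R"

lemma regD: "s \<in> S \<Longrightarrow> r \<in> carrier R \<Longrightarrow> s \<otimes> r = \<zero> \<Longrightarrow> r = \<zero>"
  and reg_carrier: "s \<in> S \<Longrightarrow> s \<in> carrier R"
  by (fact right_regularD)+

lemma hom_zero: "\<pi> \<zero> = 0"
  using hom_add[of "\<zero>" "\<zero>"] add_cancel_left_right[of "\<pi> \<zero>" "\<pi> \<zero>"] by simp

lemma one_neq_zero: "\<one> \<noteq> \<zero>"
  using hom_one hom_zero by force

lemma mult_S: "multiplicative_set R S"
  by (rule multiplicative_set_right_regular[OF ring_axioms one_neq_zero])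

lemma S_mult: "s \<in> S \<Longrightarrow> t \<in> S \<Longrightarrow> s \<otimes> t \<in> S"
  and S_one: "\<one> \<in> S"
  using mult_S by (auto simp: multiplicative_set_def)

lemma denomE:
  assumes "r \<in> carrier R"
  obtains t where "t \<in> P" "t \<in> S" "t \<in> carrier R" "r \<otimes> t \<in> P"
  using P_denom[OF assms] P_regular P_carrier by blast

text \<open>If \<pi> s = 0, then s t = 0 for the t that carries s into P; as t is nonzero, this
  contradicts regularity of s.\<close>

lemma hom_regular: "s \<in> S \<Longrightarrow> \<pi> s \<noteq> 0"
proof
  assume s: "s \<in> S" "\<pi> s = 0"
  then obtain t where t: "t \<in> P" "t \<in> S" "t \<in> carrier R" "s \<otimes> t \<in> P"
    using denomE[OF reg_carrier[OF s(1)]] by blast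
  then have "s \<otimes> t = \<zero>"
    using P_inj s hom_mult reg_carrier by simp
  then have "t = \<zero>" by (rule regD[OF s(1) t(3)])
  with t(2) mult_S show False by (simp add: multiplicative_set_def)
qed

text \<open>This makes up for the missing injectivity of \<pi>: its kernel is torsion with respect
  to S.\<close>

lemma hom_eq_zeroE:
  assumes "r \<in> carrier R" "\<pi> r = 0"
  obtains t where "t \<in> S" "r \<otimes> t = \<zero>"
proof -
  obtain t where "t \<in> P" "t \<in> S" "t \<in> carrier R" "r \<otimes> t \<in> P"
    using denomE[OF assms(1)] by blast
  with assms show ?thesis using that P_inj hom_mult by simp
qed

lemma OreE:
  assumes "r \<in> carrier R" "s \<in> S"
  obtains t q where "t \<in> S" "q \<in> carrier R" "r \<otimes> t = s \<otimes> q"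
proof -
  obtain t where t: "t \<in> P" "t \<in> S" "t \<in> carrier R" "r \<otimes> t \<in> P"
    by (rule denomE[OF assms(1)])
  obtain t' where t': "t' \<in> P" "t' \<in> S" "t' \<in> carrier R" "s \<otimes> t' \<in> P"
    by (rule denomE[OF reg_carrier[OF assms(2)]])
  have c: "s \<in> carrier R" using assms reg_carrier by simp
  have "r \<otimes> (t \<otimes> (s \<otimes> t')) = (r \<otimes> t) \<otimes> (s \<otimes> t')"
    using t t' assms c by (simp add: m_assoc)
  also have "\<dots> = (s \<otimes> t') \<otimes> (r \<otimes> t)" using P_comm t t' by simp
  also have "\<dots> = s \<otimes> (t' \<otimes> (r \<otimes> t))" using t t' assms c by (simp add: m_assoc)
  finally show ?thesis
    using that[of "t \<otimes> (s \<otimes> t')" "t' \<otimes> (r \<otimes> t)"] t t' assms c S_mult by simp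
qed

lemma right_denominator_regular: "right_denominator_set R S"
proof -
  have "(\<lambda>t. r \<otimes> t) ` S \<inter> (\<lambda>q. s \<otimes> q) ` carrier R \<noteq> {}" if "r \<in> carrier R" "s \<in> S" for r s
    using OreE[OF that] by blast
  moreover have "\<exists>t \<in> S. r \<otimes> t = \<zero>" if "r \<in> carrier R" "s \<in> S" "s \<otimes> r = \<zero>" for r s
    using that regD[of s r] S_one by (auto intro!: bexI[of _ "\<one>"])
  ultimately show ?thesis
    using mult_S by (simp add: right_denominator_set_def right_Ore_set_def)
qed

text \<open>The fraction relation is the kernel of the map sending (r, s) to \<pi> r / \<pi> s.
  Transitivity and all computations with classes thereby reduce to arithmetic in the field.\<close>

lemma frac_rel_iff:
  "((r, s), (r', s')) \<in> right_frac_rel R S \<longleftrightarrow>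
     r \<in> carrier R \<and> s \<in> S \<and> r' \<in> carrier R \<and> s' \<in> S \<and> \<pi> r / \<pi> s = \<pi> r' / \<pi> s'"
    (is "?L \<longleftrightarrow> ?R")
proof
  assume ?L
  then obtain u v where c: "r \<in> carrier R" "s \<in> S" "r' \<in> carrier R" "s' \<in> S"
    "u \<in> carrier R" "v \<in> carrier R"
    and eq: "r \<otimes> u = r' \<otimes> v" "s \<otimes> u = s' \<otimes> v" "s \<otimes> u \<in> S"
    by (auto simp: right_frac_rel_def)
  note c = c reg_carrier[OF c(2)] reg_carrier[OF c(4)]
  have "\<pi> r * \<pi> u = \<pi> r' * \<pi> v" "\<pi> s * \<pi> u = \<pi> s' * \<pi> v" "\<pi> s * \<pi> u \<noteq> 0"
    using arg_cong[OF eq(1), of \<pi>] arg_cong[OF eq(2), of \<pi>] hom_regular[OF eq(3)] c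
    by (simp_all add: hom_mult)
  then have "\<pi> r / \<pi> s = \<pi> r' / \<pi> s'"
    by (metis mult_divide_mult_cancel_right mult_zero_right)
  with c show ?R by simp
next
  assume R: ?R
  then have c: "s \<in> carrier R" "s' \<in> carrier R" using reg_carrier by auto
  obtain t where t: "t \<in> P" "t \<in> S" "t \<in> carrier R" "s \<otimes> t \<in> P"
    by (rule denomE[OF c(1)])
  obtain t' where t': "t' \<in> P" "t' \<in> S" "t' \<in> carrier R" "s' \<otimes> t' \<in> P"
    by (rule denomE[OF c(2)])
  \<comment> \<open>Chosen so that s u and s' v are the products of s t and s' t' in the two orders.
    Both factors lie in the commutative P, so this is a common denominator.\<close>
  define u v where "u = t \<otimes> (s' \<otimes> t')" and "v = t' \<otimes> (s \<otimes> t)"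
  have uv: "u \<in> carrier R" "v \<in> carrier R" using t t' c by (auto simp: u_def v_def)
  have su: "s \<otimes> u = (s \<otimes> t) \<otimes> (s' \<otimes> t')" and sv: "s' \<otimes> v = (s' \<otimes> t') \<otimes> (s \<otimes> t)"
    using t t' c by (simp_all add: u_def v_def m_assoc)
  have eq: "s \<otimes> u = s' \<otimes> v" unfolding su sv using P_comm t t' by blast
  have suS: "s \<otimes> u \<in> S" unfolding su using S_mult t t' R by blast
  have "\<pi> r * \<pi> s' = \<pi> r' * \<pi> s"
    using R by (metis hom_regular frac_eq_eq)
  then have "(\<pi> r * \<pi> s') * (\<pi> t * \<pi> t') = (\<pi> r' * \<pi> s) * (\<pi> t * \<pi> t')"
    by simp
  then have "\<pi> (r \<otimes> u) = \<pi> (r' \<otimes> v)"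
    using R c t t' by (simp add: u_def v_def hom_mult mult_ac)
  moreover have "\<pi> (r \<otimes> u) = \<pi> (r \<otimes> u \<ominus> r' \<otimes> v) + \<pi> (r' \<otimes> v)"
    using hom_add[of "r \<otimes> u \<ominus> r' \<otimes> v" "r' \<otimes> v"] R uv
    by (simp add: a_minus_def add.m_assoc l_neg)
  ultimately have "\<pi> (r \<otimes> u \<ominus> r' \<otimes> v) = 0" by simp
  \<comment> \<open>The numerators r u and r' v agree only modulo the kernel of \<pi>; one more
    factor z from S makes them equal.\<close>
  then obtain z where z: "z \<in> S" "(r \<otimes> u \<ominus> r' \<otimes> v) \<otimes> z = \<zero>"
    using hom_eq_zeroE R uv by (metis minus_closed m_closed)
  note zc = reg_carrier[OF z(1)]
  have "r \<otimes> (u \<otimes> z) = (r \<otimes> u) \<otimes> z" using R uv zc by (simp add: m_assoc)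
  also have "\<dots> = (r \<otimes> u \<ominus> r' \<otimes> v) \<otimes> z \<oplus> (r' \<otimes> v) \<otimes> z"
    using R uv zc by (simp add: l_distr[symmetric] a_minus_def add.m_assoc l_neg)
  also have "\<dots> = (r' \<otimes> v) \<otimes> z" using z(2) R uv zc by simp
  also have "\<dots> = r' \<otimes> (v \<otimes> z)" using R uv zc by (simp add: m_assoc)
  finally have 1: "r \<otimes> (u \<otimes> z) = r' \<otimes> (v \<otimes> z)" .
  have 2: "s \<otimes> (u \<otimes> z) = s' \<otimes> (v \<otimes> z)"
    using eq c uv zc by (simp add: m_assoc[symmetric])
  have 3: "s \<otimes> (u \<otimes> z) \<in> S"
    using S_mult[OF suS z(1)] c uv zc by (simp add: m_assoc)
  have "\<exists>u \<in> carrier R. \<exists>v \<in> carrier R. r \<otimes> u = r' \<otimes> v \<and> s \<otimes> u = s' \<otimes> v \<and> s \<otimes> u \<in> S"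
    using 1 2 3 uv zc by (intro bexI[of _ "u \<otimes> z"] bexI[of _ "v \<otimes> z"]) auto
  then show ?L unfolding right_frac_rel_def using R by simp
qed

section \<open>Arithmetic of fraction classes through their values\<close>

lemma product_of_fractions:
  assumes "r1 \<in> carrier R" "s1 \<in> S" "r2 \<in> carrier R" "s2 \<in> S" "u \<in> carrier R" "t \<in> S"
    and "s1 \<otimes> u = r2 \<otimes> t"
  shows "\<pi> (r1 \<otimes> u) / \<pi> (s2 \<otimes> t) = (\<pi> r1 / \<pi> s1) * (\<pi> r2 / \<pi> s2)"
proof -
  have e: "\<pi> s1 * \<pi> u = \<pi> r2 * \<pi> t"
    using arg_cong[OF assms(7), of \<pi>] assms(1-6) reg_carrier by (simp add: hom_mult)
  \<comment> \<open>The fraction is expanded by \<open>\<pi> t\<close>, which is nonzero, and not by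
    \<open>\<pi> u\<close>, which vanishes whenever \<open>\<pi> r2\<close> does.\<close>
  have "(\<pi> r1 / \<pi> s1) * (\<pi> r2 / \<pi> s2) = (\<pi> r1 * (\<pi> r2 * \<pi> t)) / (\<pi> s1 * (\<pi> s2 * \<pi> t))"
    using hom_regular[OF assms(6)] by simp
  also have "\<dots> = \<pi> r1 * \<pi> u / (\<pi> s2 * \<pi> t)"
    unfolding e[symmetric] using hom_regular[OF assms(2)] by simp
  finally show ?thesis
    using assms reg_carrier by (simp add: hom_mult)
qed

lemma sum_of_fractions:
  assumes "r1 \<in> carrier R" "s1 \<in> S" "r2 \<in> carrier R" "s2 \<in> S" "u \<in> carrier R" "v \<in> carrier R"
    and "s1 \<otimes> u = s2 \<otimes> v" "s1 \<otimes> u \<in> S"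
  shows "\<pi> (r1 \<otimes> u \<oplus> r2 \<otimes> v) / \<pi> (s1 \<otimes> u) = \<pi> r1 / \<pi> s1 + \<pi> r2 / \<pi> s2"
proof -
  have e: "\<pi> s1 * \<pi> u = \<pi> s2 * \<pi> v" "\<pi> s1 * \<pi> u \<noteq> 0"
    using arg_cong[OF assms(7), of \<pi>] hom_regular[OF assms(8)] assms(1-6) reg_carrier
    by (simp_all add: hom_mult)
  then have nz: "\<pi> u \<noteq> 0" "\<pi> v \<noteq> 0" by auto
  have "\<pi> r1 / \<pi> s1 + \<pi> r2 / \<pi> s2 = \<pi> r1 * \<pi> u / (\<pi> s1 * \<pi> u) + \<pi> r2 * \<pi> v / (\<pi> s2 * \<pi> v)"
    using nz by simp
  also have "\<dots> = (\<pi> r1 * \<pi> u + \<pi> r2 * \<pi> v) / (\<pi> s1 * \<pi> u)"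
    unfolding e(1)[symmetric] by (rule add_divide_distrib[symmetric])
  also have "\<dots> = \<pi> (r1 \<otimes> u \<oplus> r2 \<otimes> v) / \<pi> (s1 \<otimes> u)"
    using assms(1-6) reg_carrier by (simp add: hom_mult hom_add)
  finally show ?thesis by simp
qed

text \<open>The fibre over q of the value map; by \<open>frac_rel_iff\<close> the nonempty fibres
  are exactly the classes of \<open>right_frac_rel R S\<close>.\<close>

definition frac_class :: "'f \<Rightarrow> ('a \<times> 'a) set" where
  "frac_class q = {(r, s). r \<in> carrier R \<and> s \<in> S \<and> \<pi> r / \<pi> s = q}"

definition frac_values :: "'f set" where
  "frac_values = {\<pi> r / \<pi> s | r s. r \<in> carrier R \<and> s \<in> S}"

lemma right_frac_eq: "r \<in> carrier R \<Longrightarrow> s \<in> S \<Longrightarrow> right_frac R S r s = frac_class (\<pi> r / \<pi> s)"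
  by (auto simp: right_frac_def frac_class_def frac_rel_iff)

lemma carrier_right_localization: "carrier (right_localization R S) = frac_class ` frac_values"
proof -
  have "carrier (right_localization R S) = {right_frac R S r s | r s. r \<in> carrier R \<and> s \<in> S}"
    by (auto simp: right_localization_def quotient_def right_frac_def)
  also have "\<dots> = frac_class ` frac_values"
  proof (intro equalityI subsetI)
    fix A assume "A \<in> {right_frac R S r s | r s. r \<in> carrier R \<and> s \<in> S}"
    then obtain r s where "r \<in> carrier R" "s \<in> S" "A = frac_class (\<pi> r / \<pi> s)"
      using right_frac_eq by blast
    then show "A \<in> frac_class ` frac_values"
      unfolding frac_values_def by blast
  next
    fix A assume "A \<in> frac_class ` frac_values"
    then obtain r s where "r \<in> carrier R" "s \<in> S" "A = frac_class (\<pi> r / \<pi> s)"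
      by (auto simp: frac_values_def)
    then show "A \<in> {right_frac R S r s | r s. r \<in> carrier R \<and> s \<in> S}"
      using right_frac_eq[of r s] by blast
  qed
  finally show ?thesis .
qed

text \<open>Nonempty fibres over different points differ; outside \<open>frac_values\<close> all
  fibres are empty and injectivity is lost.\<close>

lemma frac_class_inj: "inj_on frac_class frac_values"
  by (rule inj_onI) (auto simp: frac_values_def frac_class_def set_eq_iff)

lemma frac_valuesE:
  assumes "q \<in> frac_values"
  obtains r s where "(r, s) \<in> frac_class q" "r \<in> carrier R" "s \<in> S"
  using assms by (auto simp: frac_values_def frac_class_def)

lemma frac_class_mult:
  assumes "a \<in> frac_values" "b \<in> frac_values"
  shows "frac_class a \<otimes>\<^bsub>right_localization R S\<^esub> frac_class b = frac_class (a * b)"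
proof -
  obtain r1 s1 where 1: "(r1, s1) \<in> frac_class a" "r1 \<in> carrier R" "s1 \<in> S" using assms frac_valuesE by metis
  obtain r2 s2 where 2: "(r2, s2) \<in> frac_class b" "r2 \<in> carrier R" "s2 \<in> S" using assms frac_valuesE by metis
  \<comment> \<open>The Ore condition provides one admissible choice, so the union defining the
    product is not empty.\<close>
  obtain t u where "t \<in> S" "u \<in> carrier R" "s1 \<otimes> u = r2 \<otimes> t" using OreE 1 2 by metis
  note ex = 1 2 this
  show ?thesis
    unfolding right_localization_def
  proof (simp, rule Union_const)
    fix A assume "A \<in> {right_frac R S (r\<^sub>1 \<otimes> u) (s\<^sub>2 \<otimes> t) |r\<^sub>1 s\<^sub>1 r\<^sub>2 s\<^sub>2 u t.
       (r\<^sub>1, s\<^sub>1) \<in> frac_class a \<and> (r\<^sub>2, s\<^sub>2) \<in> frac_class b \<and> u \<in> carrier R \<and> t \<in> S \<and> s\<^sub>1 \<otimes> u = r\<^sub>2 \<otimes> t}"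
    then obtain r1 s1 r2 s2 u t where A: "A = right_frac R S (r1 \<otimes> u) (s2 \<otimes> t)"
      and c: "r1 \<in> carrier R" "s1 \<in> S" "r2 \<in> carrier R" "s2 \<in> S" "u \<in> carrier R" "t \<in> S"
      and v: "\<pi> r1 / \<pi> s1 = a" "\<pi> r2 / \<pi> s2 = b" and eq: "s1 \<otimes> u = r2 \<otimes> t"
      by (auto simp: frac_class_def)
    note n = hom_regular[OF c(2)] hom_regular[OF c(4)] hom_regular[OF c(6)]
    have "\<pi> (r1 \<otimes> u) / \<pi> (s2 \<otimes> t) = a * b"
      using product_of_fractions[OF c eq] v by simp
    then show "A = frac_class (a * b)"
      unfolding A using right_frac_eq c S_mult by simp
  qed (use ex in blast)
qed

lemma frac_class_add:
  assumes "a \<in> frac_values" "b \<in> frac_values"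
  shows "frac_class a \<oplus>\<^bsub>right_localization R S\<^esub> frac_class b = frac_class (a + b)"
proof -
  obtain r1 s1 where 1: "(r1, s1) \<in> frac_class a" "r1 \<in> carrier R" "s1 \<in> S" using assms frac_valuesE by metis
  obtain r2 s2 where 2: "(r2, s2) \<in> frac_class b" "r2 \<in> carrier R" "s2 \<in> S" using assms frac_valuesE by metis
  \<comment> \<open>The Ore condition for s1 and s2. The multiplier t of s1 is taken in S, which
    puts the common denominator s1 t into S.\<close>
  obtain t u where "t \<in> S" "u \<in> carrier R" "s1 \<otimes> t = s2 \<otimes> u" using OreE 1 2 reg_carrier by metis
  note ex = 1 2 this reg_carrier[OF this(1)] S_mult[OF 1(3) this(1)]
  show ?thesis
    unfolding right_localization_def
  proof (simp, rule Union_const)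
    fix A assume "A \<in> {right_frac R S (r\<^sub>1 \<otimes> u \<oplus> r\<^sub>2 \<otimes> v) (s\<^sub>1 \<otimes> u) |r\<^sub>1 s\<^sub>1 r\<^sub>2 s\<^sub>2 u v.
       (r\<^sub>1, s\<^sub>1) \<in> frac_class a \<and> (r\<^sub>2, s\<^sub>2) \<in> frac_class b \<and> u \<in> carrier R \<and> v \<in> carrier R \<and>
       s\<^sub>1 \<otimes> u = s\<^sub>2 \<otimes> v \<and> s\<^sub>1 \<otimes> u \<in> S}"
    then obtain r1 s1 r2 s2 u t where A: "A = right_frac R S (r1 \<otimes> u \<oplus> r2 \<otimes> t) (s1 \<otimes> u)"
      and c: "r1 \<in> carrier R" "s1 \<in> S" "r2 \<in> carrier R" "s2 \<in> S" "u \<in> carrier R" "t \<in> carrier R"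
      and v: "\<pi> r1 / \<pi> s1 = a" "\<pi> r2 / \<pi> s2 = b" and eq: "s1 \<otimes> u = s2 \<otimes> t" "s1 \<otimes> u \<in> S"
      by (auto simp: frac_class_def)
    note n = hom_regular[OF c(2)] hom_regular[OF c(4)]
    have "\<pi> (r1 \<otimes> u \<oplus> r2 \<otimes> t) / \<pi> (s1 \<otimes> u) = a + b"
      using sum_of_fractions[OF c eq] v by simp
    then show "A = frac_class (a + b)"
      unfolding A using right_frac_eq c eq by simp
  qed (use ex in blast)
qed

lemma frac_class_smult:
  assumes "a \<in> frac_values"
  shows "c \<odot>\<^bsub>right_localization R S\<^esub> frac_class a = frac_class (\<iota> c * a)"
proof -
  obtain r s where ex: "(r, s) \<in> frac_class a" using assms frac_valuesE by metis
  show ?thesis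
    unfolding right_localization_def
  proof (simp, rule Union_const)
    fix A assume "A \<in> {right_frac R S (c \<odot> r) s |r s. (r, s) \<in> frac_class a}"
    then show "A = frac_class (\<iota> c * a)"
      using right_frac_eq smult_closed hom_smult by (auto simp: frac_class_def)
  qed (use ex in blast)
qed

text \<open>The isomorphism is the inverse of \<open>frac_class\<close>, which assigns to a class
  its value. The formula on fractions is recorded in order to trace the x_i to the variables
  later.\<close>

theorem right_localization_iso:
  assumes "carrier B = frac_values" "monoid.mult B = (*)" "add B = (+)" "one B = 1" "smult B = (\<lambda>c b. \<iota> c * b)"
  shows "\<exists>h \<in> algebra_iso (right_localization R S) B.
           \<forall>r \<in> carrier R. \<forall>s \<in> S. h (right_frac R S r s) = \<pi> r / \<pi> s"
proof -
  define h where "h = the_inv_into frac_values frac_class"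
  have h: "h (frac_class q) = q" if "q \<in> frac_values" for q
    unfolding h_def using the_inv_into_f_f[OF frac_class_inj that] .
  have val: "\<pi> r / \<pi> s \<in> frac_values" if "r \<in> carrier R" "s \<in> S" for r s
    using that by (auto simp: frac_values_def)
  have bij: "bij_betw h (carrier (right_localization R S)) (carrier B)"
    unfolding h_def carrier_right_localization assms
    by (rule bij_betw_the_inv_into) (simp add: bij_betw_def frac_class_inj)
  \<comment> \<open>\<open>h\<close> inverts \<open>frac_class\<close> only on
    \<open>frac_values\<close>, so sums, products and scalar multiples of values must again be
    values of fractions.\<close>
  have clos: "a * b \<in> frac_values \<and> a + b \<in> frac_values \<and> \<iota> c * a \<in> frac_values"
    if a: "a \<in> frac_values" and b: "b \<in> frac_values" for a b c
  proof -
    obtain r1 s1 where 1: "r1 \<in> carrier R" "s1 \<in> S" "a = \<pi> r1 / \<pi> s1"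
      using a by (auto simp: frac_values_def)
    obtain r2 s2 where 2: "r2 \<in> carrier R" "s2 \<in> S" "b = \<pi> r2 / \<pi> s2"
      using b by (auto simp: frac_values_def)
    obtain t u where o: "t \<in> S" "u \<in> carrier R" "r2 \<otimes> t = s1 \<otimes> u" using OreE 1 2 by metis
    obtain t' u' where o': "t' \<in> S" "u' \<in> carrier R" "s1 \<otimes> t' = s2 \<otimes> u'"
      using OreE 1 2 reg_carrier by metis
    have m: "a * b = \<pi> (r1 \<otimes> u) / \<pi> (s2 \<otimes> t)"
      using product_of_fractions[of r1 s1 r2 s2 u t] 1 2 o by simp
    have p: "a + b = \<pi> (r1 \<otimes> t' \<oplus> r2 \<otimes> u') / \<pi> (s1 \<otimes> t')"
      using sum_of_fractions[OF 1(1,2) 2(1,2) reg_carrier[OF o'(1)] o'(2,3) S_mult[OF 1(2) o'(1)]] 1 2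
      by simp
    have "\<iota> c * a = \<pi> (c \<odot> r1) / \<pi> s1" using 1 hom_smult by simp
    then have "\<iota> c * a \<in> frac_values"
      using val[OF smult_closed[OF 1(1)] 1(2)] by metis
    moreover have "a * b \<in> frac_values"
      unfolding m using 1 2 o S_mult by (intro val) auto
    moreover have "a + b \<in> frac_values"
      unfolding p using 1 2 o'(1,2) S_mult reg_carrier[OF o'(1)] by (intro val) auto
    ultimately show ?thesis by blast
  qed
  have "h \<in> ring_hom (right_localization R S) B"
  proof (rule ring_hom_memI)
    show "h \<one>\<^bsub>right_localization R S\<^esub> = \<one>\<^bsub>B\<^esub>"
      using right_frac_eq[OF one_closed S_one] h[OF val[OF one_closed S_one]]
      by (simp add: right_localization_def assms hom_one)
  qed (auto simp: carrier_right_localization assms h frac_class_mult frac_class_add clos)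
  moreover have "h (c \<odot>\<^bsub>right_localization R S\<^esub> a) = c \<odot>\<^bsub>B\<^esub> h a"
    if "a \<in> carrier (right_localization R S)" for c a
    using that by (auto simp: carrier_right_localization assms h frac_class_smult clos)
  ultimately have "h \<in> algebra_iso (right_localization R S) B"
    using bij by (simp add: algebra_iso_def ring_iso_def)
  moreover have "h (right_frac R S r s) = \<pi> r / \<pi> s" if "r \<in> carrier R" "s \<in> S" for r s
    using right_frac_eq[OF that] h[OF val[OF that]] by simp
  ultimately show ?thesis by blast
qed

end

section \<open>The free algebra and its representations\<close>

abbreviation supp :: "('g list \<Rightarrow> 'k::zero) \<Rightarrow> 'g list set" where
  "supp f \<equiv> {w. f w \<noteq> 0}"

lemma free_algebra_simps [simp]:
  "f \<in> carrier (free_algebra G) \<longleftrightarrow> finite (supp f) \<and> supp f \<subseteq> lists G"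
  "f \<otimes>\<^bsub>free_algebra G\<^esub> g = (\<lambda>w. \<Sum>i\<le>length w. f (take i w) * g (drop i w))"
  "\<one>\<^bsub>free_algebra G\<^esub> = word []"
  "\<zero>\<^bsub>free_algebra G\<^esub> = (\<lambda>w. 0)"
  "f \<oplus>\<^bsub>free_algebra G\<^esub> g = (\<lambda>w. f w + g w)"
  "c \<odot>\<^bsub>free_algebra G\<^esub> f = (\<lambda>w. c * f w)"
  by (simp_all add: free_algebra_def word_def)

text \<open>The product of \<open>free_algebra G\<close> is the same for every G; naming it without
  G keeps its laws free of carrier conditions.\<close>

definition conv :: "('g list \<Rightarrow> 'k::field) \<Rightarrow> ('g list \<Rightarrow> 'k) \<Rightarrow> 'g list \<Rightarrow> 'k" where
  "conv f g = (\<lambda>w. \<Sum>i\<le>length w. f (take i w) * g (drop i w))"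

lemma mult_free_algebra: "f \<otimes>\<^bsub>free_algebra G\<^esub> g = conv f g"
  by (simp add: conv_def)

text \<open>The splittings of w at a position correspond to the pairs (u, v) with
  \<open>u @ v = w\<close>. In this form the product is visibly the bilinear extension of
  concatenation.\<close>

lemma conv_eq_sum:
  assumes "finite U" "finite V" "supp f \<subseteq> U" "supp g \<subseteq> V"
  shows "conv f g w = (\<Sum>u\<in>U. \<Sum>v\<in>V. f u * g v * of_bool (u @ v = w))"
proof -
  let ?D = "{(u, v). u @ v = w}" and ?s = "\<lambda>i. (take i w, drop i w)"
  have bij: "bij_betw ?s {..length w} ?D"
    by (rule bij_betw_byWitness[of _ "\<lambda>(u, v). length u"]) auto
  have fin: "finite ?D" using bij_betw_finite[OF bij] by simp
  have "conv f g w = (\<Sum>(u, v)\<in>?D. f u * g v)"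
    unfolding conv_def using sum.reindex_bij_betw[OF bij, of "\<lambda>(u, v). f u * g v"] by simp
  also have "\<dots> = (\<Sum>(u, v)\<in>?D \<inter> U \<times> V. f u * g v)"
    using assms(3,4) by (intro sum.mono_neutral_right[OF fin]) auto
  also have "\<dots> = (\<Sum>(u, v)\<in>U \<times> V. f u * g v * of_bool (u @ v = w))"
    using assms(1,2) by (intro sum.mono_neutral_cong_left) auto
  also have "\<dots> = (\<Sum>u\<in>U. \<Sum>v\<in>V. f u * g v * of_bool (u @ v = w))"
    by (simp only: sum.cartesian_product)
  finally show ?thesis .
qed

lemma supp_conv: "supp (conv f g) \<subseteq> (\<lambda>(u, v). u @ v) ` (supp f \<times> supp g)"
proof
  fix w assume "w \<in> supp (conv f g)"
  then have "(\<Sum>i\<le>length w. f (take i w) * g (drop i w)) \<noteq> 0"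
    by (simp add: conv_def)
  then obtain i where "f (take i w) * g (drop i w) \<noteq> 0"
    by (rule sum.not_neutral_contains_not_neutral)
  then show "w \<in> (\<lambda>(u, v). u @ v) ` (supp f \<times> supp g)"
    by (intro image_eqI[of _ _ "(take i w, drop i w)"]) auto
qed

lemma finite_supp_conv: "finite (supp f) \<Longrightarrow> finite (supp g) \<Longrightarrow> finite (supp (conv f g))"
  using finite_subset[OF supp_conv] by blast

text \<open>\<open>\<iota>\<close> turns the commutative ring \<open>'v\<close> into a K-algebra. It
  is instantiated by the identity of K, by constant polynomials and by constant rational
  functions.\<close>

locale scalar_hom =
  fixes \<iota> :: "'k::field \<Rightarrow> 'v::comm_ring_1"
  assumes scalar_add: "\<iota> (a + b) = \<iota> a + \<iota> b"
    and scalar_mult: "\<iota> (a * b) = \<iota> a * \<iota> b"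
    and scalar_one: "\<iota> 1 = 1"
begin

lemma scalar_zero: "\<iota> 0 = 0"
  using scalar_add[of 0 0] by simp

lemma scalar_sum: "\<iota> (sum f A) = (\<Sum>a\<in>A. \<iota> (f a))"
  by (induction A rule: infinite_finite_induct) (auto simp: scalar_add scalar_zero)

definition lin :: "('g list \<Rightarrow> 'v) \<Rightarrow> ('g list \<Rightarrow> 'k) \<Rightarrow> 'v" where
  "lin h f = (\<Sum>w\<in>supp f. \<iota> (f w) * h w)"

lemma lin_superset: "finite W \<Longrightarrow> supp f \<subseteq> W \<Longrightarrow> lin h f = (\<Sum>w\<in>W. \<iota> (f w) * h w)"
  unfolding lin_def by (rule sum.mono_neutral_left) (auto simp: scalar_zero)

lemma lin_add:
  assumes "finite (supp f)" "finite (supp g)"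
  shows "lin h (\<lambda>w. f w + g w) = lin h f + lin h g"
proof -
  let ?W = "supp f \<union> supp g"
  have W: "finite ?W" using assms by blast
  show ?thesis
    unfolding lin_superset[OF W, of f h, simplified] lin_superset[OF W, of g h, simplified]
    by (subst lin_superset[OF W]) (auto simp: scalar_add scalar_zero distrib_right sum.distrib)
qed

lemma lin_smult: "lin h (\<lambda>w. c * f w) = \<iota> c * lin h f"
  by (cases "c = 0") (simp_all add: lin_def scalar_mult scalar_zero sum_distrib_left mult.assoc)

lemma lin_word: "lin h (word v) = h v"
proof -
  have "supp (word v :: 'g list \<Rightarrow> 'k) = {v}" for v :: "'g list" by (auto simp: word_def)
  then show ?thesis by (simp add: lin_def word_def scalar_one)
qed

text \<open>After exchanging the sums, each pair (u, v) contributes only at the word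
  \<open>u @ v\<close>. With h reading a coefficient this yields associativity, with
  \<open>h w = foldr act w v\<close> it yields multiplicativity of \<open>rho\<close>.\<close>

lemma lin_conv:
  assumes "finite (supp f)" "finite (supp g)"
  shows "lin h (conv f g) = lin (\<lambda>u. lin (\<lambda>v. h (u @ v)) g) f"
proof -
  let ?W = "(\<lambda>(u, v). u @ v) ` (supp f \<times> supp g)"
  have W: "finite ?W" using assms by blast
  have "lin h (conv f g) = (\<Sum>w\<in>?W. \<iota> (conv f g w) * h w)"
    by (rule lin_superset[OF W supp_conv])
  also have "\<dots> = (\<Sum>w\<in>?W. \<Sum>u\<in>supp f. \<Sum>v\<in>supp g. \<iota> (f u) * \<iota> (g v) * (\<iota> (of_bool (u @ v = w)) * h w))"
    by (simp add: conv_eq_sum[OF assms] scalar_sum scalar_mult sum_distrib_right mult.assoc)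
  also have "\<dots> = (\<Sum>u\<in>supp f. \<Sum>v\<in>supp g. \<Sum>w\<in>?W. \<iota> (f u) * \<iota> (g v) * (\<iota> (of_bool (u @ v = w)) * h w))"
    by (rule trans[OF sum.swap]) (intro sum.cong refl sum.swap)
  also have "\<dots> = (\<Sum>u\<in>supp f. \<Sum>v\<in>supp g. \<iota> (f u) * \<iota> (g v) * h (u @ v))"
  proof (intro sum.cong refl)
    fix u v assume uv: "u \<in> supp f" "v \<in> supp g"
    have "(\<Sum>w\<in>?W. \<iota> (f u) * \<iota> (g v) * (\<iota> (of_bool (u @ v = w)) * h w))
        = (\<Sum>w\<in>{u @ v}. \<iota> (f u) * \<iota> (g v) * (\<iota> (of_bool (u @ v = w)) * h w))"
      using uv W by (intro sum.mono_neutral_right) (auto simp: scalar_zero)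
    then show "(\<Sum>w\<in>?W. \<iota> (f u) * \<iota> (g v) * (\<iota> (of_bool (u @ v = w)) * h w)) = \<iota> (f u) * \<iota> (g v) * h (u @ v)"
      by (simp add: scalar_one)
  qed
  also have "\<dots> = lin (\<lambda>u. lin (\<lambda>v. h (u @ v)) g) f"
    by (simp add: lin_def sum_distrib_left mult.assoc)
  finally show ?thesis .
qed

end

interpretation coeff: scalar_hom "\<lambda>c::'k::field. c"
  by unfold_locales auto

lemma coeff_lin: "finite (supp f) \<Longrightarrow> coeff.lin (\<lambda>v. of_bool (v = w)) f = f w"
proof -
  assume f: "finite (supp f)"
  have "f v * of_bool (v = w) = (if v = w then f v else 0)" for v by simp
  then have "coeff.lin (\<lambda>v. of_bool (v = w)) f = (\<Sum>v\<in>supp f. if v = w then f v else 0)"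
    by (simp only: coeff.lin_def)
  also have "\<dots> = f w" using f by simp
  finally show ?thesis .
qed

text \<open>Reading off a coefficient as a linear combination turns associativity into \<open>append_assoc\<close>.\<close>

lemma conv_assoc:
  assumes "finite (supp f)" "finite (supp g)" "finite (supp k)"
  shows "conv (conv f g) k = conv f (conv g k)"
proof
  fix w :: "'a list"
  let ?h = "\<lambda>v. of_bool (v = w) :: 'b"
  have "conv (conv f g) k w = coeff.lin ?h (conv (conv f g) k)"
    by (rule coeff_lin[symmetric]) (intro finite_supp_conv assms)
  also have "\<dots> = coeff.lin ?h (conv f (conv g k))"
    by (simp only: coeff.lin_conv finite_supp_conv assms append_assoc)
  also have "\<dots> = conv f (conv g k) w"
    by (rule coeff_lin) (intro finite_supp_conv assms)
  finally show "conv (conv f g) k w = conv f (conv g k) w" .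
qed

lemma finite_supp_word: "finite (supp (word w))"
  by (rule finite_subset[of _ "{w}"]) (auto simp: word_def)

lemma conv_word: "conv (word u) (word v) = word (u @ v)"
proof
  fix w
  have "conv (word u) (word v) w = (\<Sum>u'\<in>{u}. \<Sum>v'\<in>{v}. word u u' * word v v' * of_bool (u' @ v' = w))"
    by (rule conv_eq_sum) (auto simp: word_def)
  then show "conv (word u) (word v) w = word (u @ v) w"
    by (auto simp: word_def)
qed

lemma conv_add_left: "conv (\<lambda>w. f w + g w) k = (\<lambda>w. conv f k w + conv g k w)"
  by (simp add: conv_def distrib_right sum.distrib)

lemma conv_add_right: "conv k (\<lambda>w. f w + g w) = (\<lambda>w. conv k f w + conv k g w)"
  by (simp add: conv_def distrib_left sum.distrib)

lemma conv_one_left: "conv (word []) f = f"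
proof
  fix w
  have "conv (word []) f w = (\<Sum>i\<in>{0}. word [] (take i w) * f (drop i w))"
    unfolding conv_def by (rule sum.mono_neutral_right) (auto simp: word_def)
  then show "conv (word []) f w = f w" by (simp add: word_def)
qed

lemma conv_one_right: "conv f (word []) = f"
proof
  fix w
  have "conv f (word []) w = (\<Sum>i\<in>{length w}. f (take i w) * word [] (drop i w))"
    unfolding conv_def by (rule sum.mono_neutral_right) (auto simp: word_def)
  then show "conv f (word []) w = f w" by (simp add: word_def)
qed

lemma supp_conv_lists:
  assumes "supp f \<subseteq> lists G" "supp g \<subseteq> lists G"
  shows "supp (conv f g) \<subseteq> lists G"
  using assms supp_conv[of f g] by fastforce

lemma word_carrier: "w \<in> lists G \<Longrightarrow> word w \<in> carrier (free_algebra G)"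
  by (auto simp: word_def)

lemma ring_free_algebra: "ring (free_algebra G :: ('k::field, 'g list \<Rightarrow> 'k) module)"
proof (rule ringI)
  let ?A = "free_algebra G :: ('k, 'g list \<Rightarrow> 'k) module"
  show "abelian_group ?A"
  proof (rule abelian_groupI)
    fix f g assume *: "f \<in> carrier ?A" "g \<in> carrier ?A"
    have "supp (\<lambda>w. f w + g w) \<subseteq> supp f \<union> supp g" by auto
    with * show "f \<oplus>\<^bsub>?A\<^esub> g \<in> carrier ?A"
      by (auto intro: finite_subset)
  next
    fix f assume "f \<in> carrier ?A"
    then show "\<exists>g \<in> carrier ?A. g \<oplus>\<^bsub>?A\<^esub> f = \<zero>\<^bsub>?A\<^esub>"
      by (intro bexI[of _ "\<lambda>w. - f w"]) auto
  qed (auto simp: add_ac)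
  show "Group.monoid ?A"
  proof (rule monoidI)
    show "\<one>\<^bsub>?A\<^esub> \<in> carrier ?A" using word_carrier[of "[]" G] by (simp del: free_algebra_simps(1))
  next
    fix f g assume "f \<in> carrier ?A" "g \<in> carrier ?A"
    then show "f \<otimes>\<^bsub>?A\<^esub> g \<in> carrier ?A"
      unfolding mult_free_algebra by (simp add: finite_supp_conv supp_conv_lists)
  next
    fix f g h assume "f \<in> carrier ?A" "g \<in> carrier ?A" "h \<in> carrier ?A"
    then show "f \<otimes>\<^bsub>?A\<^esub> g \<otimes>\<^bsub>?A\<^esub> h = f \<otimes>\<^bsub>?A\<^esub> (g \<otimes>\<^bsub>?A\<^esub> h)"
      unfolding mult_free_algebra by (intro conv_assoc) auto
  qed (simp_all only: mult_free_algebra free_algebra_simps(3) conv_one_left conv_one_right)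
qed (simp_all only: mult_free_algebra free_algebra_simps(5) conv_add_left conv_add_right)

lemma zero_free_algebra_closed: "(\<lambda>w. 0) \<in> carrier (free_algebra G :: ('k::field, 'g list \<Rightarrow> 'k) module)"
  by simp

lemma add_free_algebra_closed:
  "f \<in> carrier (free_algebra G) \<Longrightarrow> g \<in> carrier (free_algebra G) \<Longrightarrow> (\<lambda>w. f w + g w) \<in> carrier (free_algebra G)"
  using abelian_monoid.a_closed[OF abelian_group.axioms(1)[OF ring.is_abelian_group[OF ring_free_algebra]], of f G g]
  unfolding free_algebra_simps(5) .

lemma conv_closed:
  "f \<in> carrier (free_algebra G) \<Longrightarrow> g \<in> carrier (free_algebra G) \<Longrightarrow> conv f g \<in> carrier (free_algebra G)"
  using monoid.m_closed[OF ring.is_monoid[OF ring_free_algebra], of f G g] unfolding mult_free_algebra .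

lemma smult_free_algebra_closed:
  "f \<in> carrier (free_algebra G) \<Longrightarrow> (\<lambda>w. c * f w) \<in> carrier (free_algebra G)"
  by (cases "c = 0") auto

lemma uminus_free_algebra:
  fixes f :: "'g list \<Rightarrow> 'k::field"
  assumes "f \<in> carrier (free_algebra G)"
  shows "\<ominus>\<^bsub>free_algebra G\<^esub> f = - f"
proof -
  interpret ring "free_algebra G :: ('k, 'g list \<Rightarrow> 'k) module" by (rule ring_free_algebra)
  show ?thesis by (rule minus_equality) (use assms in auto)
qed

lemma free_algebra_idealI:
  fixes J :: "('g list \<Rightarrow> 'k::field) set"
  assumes sub: "J \<subseteq> carrier (free_algebra G)"
    and zero: "(\<lambda>w. 0) \<in> J"
    and add: "\<And>f g. f \<in> J \<Longrightarrow> g \<in> J \<Longrightarrow> (\<lambda>w. f w + g w) \<in> J"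
    and smult: "\<And>c f. f \<in> J \<Longrightarrow> (\<lambda>w. c * f w) \<in> J"
    and conv: "\<And>f g. f \<in> J \<Longrightarrow> g \<in> carrier (free_algebra G) \<Longrightarrow> conv g f \<in> J"
      "\<And>f g. f \<in> J \<Longrightarrow> g \<in> carrier (free_algebra G) \<Longrightarrow> conv f g \<in> J"
  shows "ideal J (free_algebra G)"
proof (rule idealI[OF ring_free_algebra])
  let ?A = "free_algebra G :: ('k, 'g list \<Rightarrow> 'k) module"
  interpret ring ?A by (rule ring_free_algebra)
  show "subgroup J (add_monoid ?A)"
  proof (rule add.subgroupI)
    show "J \<subseteq> carrier ?A" by (rule sub)
    show "J \<noteq> {}" using zero by blast
  next
    fix f assume f: "f \<in> J"
    then have "\<ominus>\<^bsub>?A\<^esub> f = - f" using sub by (intro uminus_free_algebra) blast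
    also have "\<dots> = (\<lambda>w. - 1 * f w)" by (simp add: fun_eq_iff)
    finally show "\<ominus>\<^bsub>?A\<^esub> f \<in> J" using smult[OF f, of "- 1"] by simp
  next
    fix f g assume "f \<in> J" "g \<in> J"
    then show "f \<oplus>\<^bsub>?A\<^esub> g \<in> J" unfolding free_algebra_simps(5) by (rule add)
  qed
next
  fix f g :: "'g list \<Rightarrow> 'k" assume "f \<in> J" "g \<in> carrier (free_algebra G)"
  then show "g \<otimes>\<^bsub>free_algebra G\<^esub> f \<in> J" "f \<otimes>\<^bsub>free_algebra G\<^esub> g \<in> J"
    unfolding mult_free_algebra by (rule conv)+
qed

lemma free_algebra_finite: "f \<in> carrier (free_algebra G) \<Longrightarrow> finite (supp f)"
  unfolding free_algebra_simps(1) by (rule conjunct1)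

text \<open>The support is emptied one word at a time; f is its restriction away from v plus a
  multiple of \<open>word v\<close>.\<close>

lemma free_algebra_induct [consumes 1, case_names zero add smult_word]:
  fixes f :: "'g list \<Rightarrow> 'k::field"
  assumes "f \<in> carrier (free_algebra G)"
    and zero: "P (\<lambda>w. 0)"
    and add: "\<And>f g. f \<in> carrier (free_algebra G) \<Longrightarrow> g \<in> carrier (free_algebra G)
      \<Longrightarrow> P f \<Longrightarrow> P g \<Longrightarrow> P (\<lambda>w. f w + g w)"
    and word: "\<And>c v. v \<in> lists G \<Longrightarrow> P (\<lambda>w. c * word v w)"
  shows "P f"
proof -
  have "P f" if "finite W" "supp f \<subseteq> W" "W \<subseteq> lists G" for W f
    using that
  proof (induction W arbitrary: f rule: finite_induct)
    case empty
    then have "f = (\<lambda>w. 0)" by auto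
    then show ?case using zero by simp
  next
    case (insert v W)
    let ?g = "f(v := 0)"
    have g: "supp ?g \<subseteq> W" using insert.prems(1) by auto
    then have "?g \<in> carrier (free_algebra G)"
      unfolding free_algebra_simps(1)
      using insert.prems(2) finite_subset[OF g insert.hyps(1)] g by blast
    moreover have "(\<lambda>w. f v * word v w) \<in> carrier (free_algebra G)"
      using insert.prems(2) by (auto simp: word_def)
    moreover have "P ?g" by (rule insert.IH[OF g]) (use insert.prems(2) in blast)
    moreover have "P (\<lambda>w. f v * word v w)" by (rule word) (use insert.prems(2) in blast)
    ultimately have "P (\<lambda>w. ?g w + f v * word v w)" by (rule add)
    also have "(\<lambda>w. ?g w + f v * word v w) = f" by (auto simp: word_def)
    finally show ?case .
  qed
  then show ?thesis using assms(1) by auto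
qed

text \<open>Any K-linear operators, one per letter, give a representation of the free algebra;
  relations are imposed only in \<open>osi_ideal_kernel\<close>. Linearity is demanded over K alone,
  because dividing by x_i and dropping the remainder is not linear over the polynomials.\<close>

locale free_rep = scalar_hom \<iota>
  for \<iota> :: "'k::field \<Rightarrow> 'v::comm_ring_1" +
  fixes act :: "'g \<Rightarrow> 'v \<Rightarrow> 'v"
  assumes act_add: "act x (u + v) = act x u + act x v"
    and act_smult: "act x (\<iota> c * v) = \<iota> c * act x v"
begin

definition rho :: "('g list \<Rightarrow> 'k) \<Rightarrow> 'v \<Rightarrow> 'v" where
  "rho f v = lin (\<lambda>w. foldr act w v) f"

lemma act_lin:
  fixes h :: "'c list \<Rightarrow> 'v"
  shows "act x (lin h f) = lin (\<lambda>w. act x (h w)) f"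
proof -
  have "act x 0 = 0" using act_add[of x 0 0] by simp
  then have "act x (sum h' A) = (\<Sum>a\<in>A. act x (h' a))" for h' :: "'c list \<Rightarrow> 'v" and A
    by (induction A rule: infinite_finite_induct) (auto simp: act_add)
  then show ?thesis by (simp add: lin_def act_smult)
qed

lemma foldr_lin: "foldr act u (lin h f) = lin (\<lambda>w. foldr act u (h w)) f"
  by (induction u) (auto simp: act_lin)

lemma rho_conv: "finite (supp f) \<Longrightarrow> finite (supp g) \<Longrightarrow> rho (conv f g) v = rho f (rho g v)"
  by (simp add: rho_def lin_conv foldr_lin)

lemma rho_add: "finite (supp f) \<Longrightarrow> finite (supp g) \<Longrightarrow> rho (\<lambda>w. f w + g w) v = rho f v + rho g v"
  by (simp add: rho_def lin_add)

lemma rho_smult: "rho (\<lambda>w. c * f w) v = \<iota> c * rho f v"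
  by (simp add: rho_def lin_smult)

lemma rho_word: "rho (word w) v = foldr act w v"
  by (simp add: rho_def lin_word)

lemma rho_uminus: "rho (\<lambda>w. - f w) v = - rho f v"
proof -
  have "\<iota> (- 1) = - 1"
    using scalar_add[of 1 "-1"] by (simp add: scalar_one scalar_zero eq_neg_iff_add_eq_0 add.commute)
  then show ?thesis using rho_smult[of "-1" f v] by simp
qed

lemma rho_diff: "finite (supp f) \<Longrightarrow> finite (supp g) \<Longrightarrow> rho (f - g) v = rho f v - rho g v"
  using rho_add[of f "\<lambda>w. - g w" v] by (simp add: rho_uminus fun_diff_def)

lemma rho_zero: "rho (\<lambda>w. 0) v = 0"
  using rho_smult[of 0 "\<lambda>w. 0" v] by (simp add: scalar_zero)

lemma rho_of_add: "rho f (u + v) = rho f u + rho f v"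
proof -
  have "foldr act w (u + v) = foldr act w u + foldr act w v" for w
    by (induction w) (auto simp: act_add)
  then show ?thesis by (simp add: rho_def lin_def distrib_left sum.distrib)
qed

lemma rho_of_zero: "rho f 0 = 0"
  using rho_of_add[of f 0 0] by simp

text \<open>Together with the minimality of \<open>osi_ideal n\<close>, this reduces the claim that
  the whole ideal acts as zero to a check on the relators.\<close>

lemma kernel_ideal: "ideal {f \<in> carrier (free_algebra G). \<forall>v. rho f v = 0} (free_algebra G)"
proof (rule free_algebra_idealI)
  let ?N = "{f \<in> carrier (free_algebra G). \<forall>v. rho f v = 0}"
  show "?N \<subseteq> carrier (free_algebra G)" by blast
  show "(\<lambda>w. 0) \<in> ?N"
    using zero_free_algebra_closed rho_zero by (intro CollectI conjI allI)
next
  fix f g assume "f \<in> {f \<in> carrier (free_algebra G). \<forall>v. rho f v = 0}"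
    "g \<in> {f \<in> carrier (free_algebra G). \<forall>v. rho f v = 0}"
  then have f: "f \<in> carrier (free_algebra G)" "\<And>v. rho f v = 0"
    and g: "g \<in> carrier (free_algebra G)" "\<And>v. rho g v = 0" by blast+
  have "rho (\<lambda>w. f w + g w) v = 0" for v
    by (simp only: rho_add[OF free_algebra_finite[OF f(1)] free_algebra_finite[OF g(1)]] f(2) g(2) add_0)
  then show "(\<lambda>w. f w + g w) \<in> {f \<in> carrier (free_algebra G). \<forall>v. rho f v = 0}"
    by (intro CollectI conjI allI add_free_algebra_closed f(1) g(1))
next
  fix f c assume "f \<in> {f \<in> carrier (free_algebra G). \<forall>v. rho f v = 0}"
  then have f: "f \<in> carrier (free_algebra G)" "\<And>v. rho f v = 0" by blast+
  have "rho (\<lambda>w. c * f w) v = 0" for v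
    by (simp only: rho_smult f(2) mult_zero_right)
  then show "(\<lambda>w. c * f w) \<in> {f \<in> carrier (free_algebra G). \<forall>v. rho f v = 0}"
    by (intro CollectI conjI allI smult_free_algebra_closed f(1))
next
  fix f g :: "'g list \<Rightarrow> 'k"
  assume "f \<in> {f \<in> carrier (free_algebra G). \<forall>v. rho f v = 0}" and g: "g \<in> carrier (free_algebra G)"
  then have f: "f \<in> carrier (free_algebra G)" "\<And>v. rho f v = 0" by blast+
  have r: "rho (conv g f) v = 0" "rho (conv f g) v = 0" for v
    by (simp_all only: rho_conv free_algebra_finite[OF f(1)] free_algebra_finite[OF g] f(2) rho_of_zero)
  show "conv g f \<in> {f \<in> carrier (free_algebra G). \<forall>v. rho f v = 0}"
    by (intro CollectI conjI allI conv_closed f(1) g r)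
  show "conv f g \<in> {f \<in> carrier (free_algebra G). \<forall>v. rho f v = 0}"
    by (intro CollectI conjI allI conv_closed f(1) g r)
qed

end

section \<open>The quotient algebra and the involution\<close>

lemma minus_free_algebra:
  fixes f :: "'g list \<Rightarrow> 'k::field"
  assumes "g \<in> carrier (free_algebra G)"
  shows "f \<ominus>\<^bsub>free_algebra G\<^esub> g = f - g"
  by (simp add: a_minus_def uminus_free_algebra[OF assms] fun_eq_iff)

lemma minus_free_algebra_closed:
  fixes f :: "'g list \<Rightarrow> 'k::field"
  assumes "f \<in> carrier (free_algebra G)" "g \<in> carrier (free_algebra G)"
  shows "f - g \<in> carrier (free_algebra G)"
proof -
  interpret ring "free_algebra G :: ('k, 'g list \<Rightarrow> 'k) module" by (rule ring_free_algebra)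
  show ?thesis using minus_closed[OF assms] minus_free_algebra[OF assms(2)] by simp
qed

lemma conv_scalar: "conv (\<lambda>w. c * word [] w) f = (\<lambda>w. c * f w)"
proof -
  have "conv (\<lambda>w. c * word [] w) f = (\<lambda>w. c * conv (word []) f w)"
    by (simp add: conv_def sum_distrib_left mult.assoc)
  then show ?thesis by (simp add: conv_one_left)
qed

lemma conv_diff_left: "conv (f - g) h = conv f h - conv g h"
  by (simp add: conv_def fun_eq_iff left_diff_distrib sum_subtractf)

lemma conv_diff_right: "conv h (f - g) = conv h f - conv h g"
  by (simp add: conv_def fun_eq_iff right_diff_distrib sum_subtractf)

lemma osi_relators_carrier: "osi_relators n \<subseteq> carrier (free_algebra (gens n) :: ('k::field, gen list \<Rightarrow> 'k) module)"
proof -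
  have "word u - word v \<in> carrier (free_algebra (gens n) :: ('k, gen list \<Rightarrow> 'k) module)"
    if "u \<in> lists (gens n)" "v \<in> lists (gens n)" for u v
    by (intro minus_free_algebra_closed word_carrier that)
  then show ?thesis
    unfolding osi_relators_def by (auto simp: gens_def simp del: free_algebra_simps(1))
qed

lemma ideal_osi: "ideal (osi_ideal n) (free_algebra (gens n) :: ('k::field, gen list \<Rightarrow> 'k) module)"
  unfolding osi_ideal_def by (rule ring.genideal_ideal[OF ring_free_algebra osi_relators_carrier])

lemma osi_relators_ideal: "osi_relators n \<subseteq> osi_ideal n"
  unfolding osi_ideal_def by (rule ring.genideal_self[OF ring_free_algebra osi_relators_carrier])

lemma osi_ideal_minimal:
  "ideal J (free_algebra (gens n)) \<Longrightarrow> osi_relators n \<subseteq> J \<Longrightarrow> osi_ideal n \<subseteq> J"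
  unfolding osi_ideal_def by (rule ring.genideal_minimal[OF ring_free_algebra])

lemma osi_ideal_carrier: "f \<in> osi_ideal n \<Longrightarrow> f \<in> carrier (free_algebra (gens n))"
  using ideal.Icarr[OF ideal_osi] .

lemma osi_ideal_conv:
  assumes "f \<in> osi_ideal n" "g \<in> carrier (free_algebra (gens n))"
  shows "conv g f \<in> osi_ideal n" "conv f g \<in> osi_ideal n"
  using ideal.I_l_closed[OF ideal_osi assms] ideal.I_r_closed[OF ideal_osi assms]
  unfolding mult_free_algebra by auto

lemma osi_ideal_add: "f \<in> osi_ideal n \<Longrightarrow> g \<in> osi_ideal n \<Longrightarrow> (\<lambda>w. f w + g w) \<in> osi_ideal n"
  using additive_subgroup.a_closed[OF ideal.axioms(1)[OF ideal_osi], of f n g] by simp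

lemma osi_ideal_zero: "(\<lambda>w. 0) \<in> osi_ideal n"
  using additive_subgroup.zero_closed[OF ideal.axioms(1)[OF ideal_osi], of n] by simp

lemma osi_ideal_smult:
  assumes "f \<in> osi_ideal n"
  shows "(\<lambda>w. c * f w) \<in> osi_ideal n"
proof -
  have "(\<lambda>w. c * word [] w) \<in> carrier (free_algebra (gens n))"
    by (intro smult_free_algebra_closed word_carrier) simp
  from osi_ideal_conv(1)[OF assms this] show ?thesis by (simp add: conv_scalar)
qed

section \<open>The quotient algebra in terms of coset representatives\<close>

definition cls :: "nat \<Rightarrow> (gen list \<Rightarrow> 'k::field) \<Rightarrow> (gen list \<Rightarrow> 'k) set" where
  "cls n f = osi_ideal n +>\<^bsub>free_algebra (gens n)\<^esub> f"

lemma cls_eq_iff: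
  assumes "f \<in> carrier (free_algebra (gens n))" "g \<in> carrier (free_algebra (gens n))"
  shows "cls n f = cls n g \<longleftrightarrow> f - g \<in> osi_ideal n"
  using ring.quotient_eq_iff_same_a_r_cos[OF ring_free_algebra ideal_osi assms]
  by (simp add: cls_def minus_free_algebra[OF assms(2)])

lemma cls_eq_image: "cls n f = (\<lambda>h w. h w + f w) ` osi_ideal n"
  by (auto simp: cls_def a_r_coset_def r_coset_def)

lemma osi_algebra_simps:
  "carrier (osi_algebra K n) = cls n ` carrier (free_algebra (gens n))"
  "\<one>\<^bsub>osi_algebra K n\<^esub> = cls n (word [])"
  "\<zero>\<^bsub>osi_algebra K n\<^esub> = cls n (\<lambda>w. 0)"
  "osi_gen K n g = cls n (word [g])"
proof -
  show "carrier (osi_algebra K n) = cls n ` carrier (free_algebra (gens n))"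
    unfolding osi_algebra_def ring.defs FactRing_def A_RCOSETS_def' cls_def by auto
  show "\<zero>\<^bsub>osi_algebra K n\<^esub> = cls n (\<lambda>w. 0)"
    by (simp add: osi_algebra_def ring.defs FactRing_def cls_eq_image)
qed (simp_all add: osi_algebra_def osi_gen_def ring.defs FactRing_def cls_def)

lemma osi_algebra_mult:
  assumes "f \<in> carrier (free_algebra (gens n))" "g \<in> carrier (free_algebra (gens n))"
  shows "cls n f \<otimes>\<^bsub>osi_algebra K n\<^esub> cls n g = cls n (conv f g)"
  using ideal.rcoset_mult_add[OF ideal_osi assms] unfolding mult_free_algebra
  by (simp add: osi_algebra_def ring.defs FactRing_def cls_def)

lemma osi_algebra_add:
  assumes "f \<in> carrier (free_algebra (gens n))" "g \<in> carrier (free_algebra (gens n))"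
  shows "cls n f \<oplus>\<^bsub>osi_algebra K n\<^esub> cls n g = cls n (\<lambda>w. f w + g w)"
proof -
  interpret ideal "osi_ideal n" "free_algebra (gens n) :: ('a, gen list \<Rightarrow> 'a) module" by (rule ideal_osi)
  show ?thesis using a_rcos_sum[OF assms]
    by (simp add: osi_algebra_def ring.defs FactRing_def cls_def)
qed

lemma osi_algebra_smult:
  assumes "f \<in> carrier (free_algebra (gens n))"
  shows "c \<odot>\<^bsub>osi_algebra K n\<^esub> cls n f = cls n (\<lambda>w. c * f w)"
proof -
  \<comment> \<open>The scalar action is a union over all members of the coset. They differ from f
    by ideal elements h, and the ideal also contains the multiples c h.\<close>
  have "cls n (\<lambda>w. c * g w) = cls n (\<lambda>w. c * f w)" if g: "g \<in> cls n f" for g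
  proof -
    obtain h where h: "h \<in> osi_ideal n" "g = (\<lambda>w. h w + f w)"
      using g by (auto simp: cls_eq_image)
    have "g \<in> carrier (free_algebra (gens n))"
      unfolding h(2) by (intro add_free_algebra_closed assms osi_ideal_carrier h)
    moreover have "(\<lambda>w. c * g w) - (\<lambda>w. c * f w) = (\<lambda>w. c * h w)"
      by (auto simp: h(2) algebra_simps)
    ultimately show ?thesis
      using osi_ideal_smult[OF h(1), of c] by (simp only: cls_eq_iff smult_free_algebra_closed assms)
  qed
  moreover have "f \<in> cls n f"
    using osi_ideal_zero by (force simp: cls_eq_image)
  ultimately have "(\<Union>g \<in> cls n f. cls n (\<lambda>w. c * g w)) = cls n (\<lambda>w. c * f w)" by blast
  then show ?thesis
    by (simp add: osi_algebra_def ring.defs module.defs FactRing_def cls_def)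
qed

text \<open>\<open>osi_algebra\<close> attaches the scalar multiplication to a quotient ring by
  \<open>ring.extend\<close>, which changes the record type but none of the ring operations.\<close>

lemma ring_extend:
  assumes "ring R"
  shows "ring (ring.extend R m)"
proof -
  have sel: "carrier (ring.extend R m) = carrier R" "monoid.mult (ring.extend R m) = monoid.mult R"
    "one (ring.extend R m) = one R" "zero (ring.extend R m) = zero R" "add (ring.extend R m) = add R"
    by (simp_all add: ring.defs)
  interpret ring R by fact
  show ?thesis
  proof (rule ringI)
    show "abelian_group (ring.extend R m)"
    proof (rule abelian_groupI, unfold sel)
      fix x assume "x \<in> carrier R"
      then show "\<exists>y \<in> carrier R. y \<oplus>\<^bsub>R\<^esub> x = \<zero>\<^bsub>R\<^esub>"
        by (intro bexI[of _ "\<ominus>\<^bsub>R\<^esub> x"]) (simp_all add: l_neg)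
    qed (simp_all add: a_ac)
    show "Group.monoid (ring.extend R m)"
      by (rule monoidI, unfold sel) (simp_all add: m_assoc)
  qed (unfold sel, simp_all add: l_distr r_distr)
qed

lemma ring_osi_algebra: "ring (osi_algebra K n)"
  unfolding osi_algebra_def by (rule ring_extend[OF ideal.quotient_is_ring[OF ideal_osi]])

text \<open>The lift of \<open>eta\<close> to the free algebra. Precomposition moves words by the
  inverse of the given map, but reversing and swapping is an involution, so \<open>word v\<close>
  goes to the reversed and swapped word.\<close>

definition tau :: "(gen list \<Rightarrow> 'k::field) \<Rightarrow> gen list \<Rightarrow> 'k" where
  "tau f = (\<lambda>w. f (rev (map swap_gen w)))"

lemma swap_gen_swap_gen [simp]: "swap_gen (swap_gen g) = g"
  by (cases g) auto

lemma rev_swap_invol [simp]: "rev (map swap_gen (rev (map swap_gen w))) = w"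
  by (simp add: rev_map[symmetric] o_def)

lemma tau_tau [simp]: "tau (tau f) = f"
  by (simp add: tau_def)

lemma tau_word: "tau (word v) = word (rev (map swap_gen v))"
proof
  fix w
  have "rev (map swap_gen w) = v \<longleftrightarrow> w = rev (map swap_gen v)"
    using rev_swap_invol by metis
  then show "tau (word v) w = word (rev (map swap_gen v)) w"
    by (simp add: tau_def word_def)
qed

text \<open>Cutting the reversed word at i is cutting w at \<open>length w - i\<close> with the two
  parts exchanged, hence the reversed order of the factors.\<close>

lemma tau_conv: "tau (conv f g) = conv (tau g) (tau f)"
proof
  fix w
  have "conv (tau g) (tau f) w
      = (\<Sum>i\<le>length w. tau g (take (length w - i) w) * tau f (drop (length w - i) w))"
    unfolding conv_def by (rule sum.reindex_bij_witness[of _ "\<lambda>i. length w - i" "\<lambda>i. length w - i"]) auto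
  also have "\<dots> = tau (conv f g) w"
    by (simp add: tau_def conv_def take_rev drop_rev take_map drop_map mult.commute)
  finally show "tau (conv f g) w = conv (tau g) (tau f) w" by simp
qed

lemma gens_swap: "swap_gen g \<in> gens n \<longleftrightarrow> g \<in> gens n"
  by (cases g) (auto simp: gens_def)

lemma tau_closed:
  assumes "f \<in> carrier (free_algebra (gens n))"
  shows "tau f \<in> carrier (free_algebra (gens n))"
proof -
  have eq: "supp (tau f) = (\<lambda>w. rev (map swap_gen w)) ` supp f"
  proof (intro equalityI subsetI)
    fix w assume "w \<in> supp (tau f)"
    then show "w \<in> (\<lambda>w. rev (map swap_gen w)) ` supp f"
      by (intro image_eqI[of _ _ "rev (map swap_gen w)"]) (simp_all only: rev_swap_invol tau_def mem_Collect_eq not_False_eq_True)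
  next
    fix w assume "w \<in> (\<lambda>w. rev (map swap_gen w)) ` supp f"
    then obtain v where "f v \<noteq> 0" "w = rev (map swap_gen v)" by blast
    then show "w \<in> supp (tau f)"
      by (simp only: rev_swap_invol tau_def mem_Collect_eq not_False_eq_True)
  qed
  have "rev (map swap_gen w) \<in> lists (gens n)" if "w \<in> supp f" for w
  proof -
    have "w \<in> lists (gens n)" using that assms unfolding free_algebra_simps(1) by blast
    then show ?thesis by (auto simp: in_lists_conv_set gens_swap)
  qed
  then have "supp (tau f) \<subseteq> lists (gens n)"
    unfolding eq by (rule image_subsetI)
  moreover have "finite (supp (tau f))"
    unfolding eq using assms unfolding free_algebra_simps(1) by (intro finite_imageI) (rule conjunct1)
  ultimately show ?thesis unfolding free_algebra_simps(1) by (intro conjI)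
qed

lemma osi_relatorsI:
  assumes "i \<in> {1..n}"
  shows "word [Y i, X i] - word [] \<in> (osi_relators n :: (gen list \<Rightarrow> 'k::field) set)" (is "_ \<in> ?S")
    and "\<lbrakk>j \<in> {1..n}; i \<noteq> j\<rbrakk> \<Longrightarrow> word [X i, Y j] - word [Y j, X i] \<in> (osi_relators n :: (gen list \<Rightarrow> 'k) set)"
    and "\<lbrakk>j \<in> {1..n}; i \<noteq> j\<rbrakk> \<Longrightarrow> word [X i, X j] - word [X j, X i] \<in> (osi_relators n :: (gen list \<Rightarrow> 'k) set)"
    and "\<lbrakk>j \<in> {1..n}; i \<noteq> j\<rbrakk> \<Longrightarrow> word [Y i, Y j] - word [Y j, Y i] \<in> (osi_relators n :: (gen list \<Rightarrow> 'k) set)"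
proof -
  show "word [Y i, X i] - word [] \<in> ?S"
    unfolding osi_relators_def by (rule UnI1, rule UnI1, rule UnI1, rule CollectI, rule exI[of _ i], intro conjI; (rule refl | rule assms))
  show "word [X i, Y j] - word [Y j, X i] \<in> ?S" if "j \<in> {1..n}" "i \<noteq> j"
    unfolding osi_relators_def by (rule UnI1, rule UnI1, rule UnI2, rule CollectI, rule exI[of _ i], rule exI[of _ j], intro conjI; (rule refl | rule assms | rule that))
  show "word [X i, X j] - word [X j, X i] \<in> ?S" if "j \<in> {1..n}" "i \<noteq> j"
    unfolding osi_relators_def by (rule UnI1, rule UnI2, rule CollectI, rule exI[of _ i], rule exI[of _ j], intro conjI; (rule refl | rule assms | rule that))
  show "word [Y i, Y j] - word [Y j, Y i] \<in> ?S" if "j \<in> {1..n}" "i \<noteq> j"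
    unfolding osi_relators_def by (rule UnI2, rule CollectI, rule exI[of _ i], rule exI[of _ j], intro conjI; (rule refl | rule assms | rule that))
qed

text \<open>The relator of y_i x_i = 1 is fixed. The mixed commutator for (i, j) goes to the mixed
  one for (j, i), and the commutators of the x and of the y are exchanged with i and j
  swapped.\<close>

lemma tau_relators:
  fixes r :: "gen list \<Rightarrow> 'k::field"
  assumes "r \<in> osi_relators n"
  shows "tau r \<in> osi_relators n"
proof -
  have diff: "tau (word u - word v :: gen list \<Rightarrow> 'k) = word (rev (map swap_gen u)) - word (rev (map swap_gen v))" for u v
    unfolding tau_word[symmetric] by (simp add: tau_def fun_eq_iff)
  have "r \<in> osi_relators n \<longrightarrow> tau r \<in> (osi_relators n :: (gen list \<Rightarrow> 'k) set)"
    by (subst osi_relators_def, intro impI, elim UnE CollectE exE conjE)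
      (simp_all add: diff osi_relatorsI del: atLeastAtMost_iff)
  with assms show ?thesis by blast
qed

text \<open>The preimage of a two-sided ideal under an anti-homomorphism is again a two-sided ideal,
  and this one contains the relators; minimality does the rest.\<close>

lemma tau_ideal:
  fixes f :: "gen list \<Rightarrow> 'k::field"
  assumes "f \<in> osi_ideal n"
  shows "tau f \<in> osi_ideal n"
proof -
  let ?J = "{f \<in> carrier (free_algebra (gens n)). tau f \<in> (osi_ideal n :: (gen list \<Rightarrow> 'k) set)}"
  have "ideal ?J (free_algebra (gens n))"
  proof (rule free_algebra_idealI)
    have "tau (\<lambda>w. 0) = (\<lambda>w. 0 :: 'k)" by (simp add: tau_def)
    then show "(\<lambda>w. 0) \<in> ?J"
      using zero_free_algebra_closed osi_ideal_zero by (metis (mono_tags, lifting) mem_Collect_eq)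
  next
    fix f g assume "f \<in> ?J" "g \<in> ?J"
    then have "f \<in> carrier (free_algebra (gens n))" "g \<in> carrier (free_algebra (gens n))"
      and "(\<lambda>w. tau f w + tau g w) \<in> osi_ideal n"
      using osi_ideal_add by blast+
    moreover have "tau (\<lambda>w. f w + g w) = (\<lambda>w. tau f w + tau g w)" by (simp add: tau_def)
    ultimately show "(\<lambda>w. f w + g w) \<in> ?J"
      using add_free_algebra_closed by (metis (mono_tags, lifting) mem_Collect_eq)
  next
    fix f c assume "f \<in> ?J"
    then have "f \<in> carrier (free_algebra (gens n))" "(\<lambda>w. c * tau f w) \<in> osi_ideal n"
      using osi_ideal_smult by blast+
    moreover have "tau (\<lambda>w. c * f w) = (\<lambda>w. c * tau f w)" by (simp add: tau_def)
    ultimately show "(\<lambda>w. c * f w) \<in> ?J"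
      using smult_free_algebra_closed by (metis (mono_tags, lifting) mem_Collect_eq)
  next
    fix f g :: "gen list \<Rightarrow> 'k"
    assume "f \<in> ?J" and g: "g \<in> carrier (free_algebra (gens n))"
    then have f: "f \<in> carrier (free_algebra (gens n))" "tau f \<in> osi_ideal n" by blast+
    show "conv g f \<in> ?J" "conv f g \<in> ?J"
      unfolding mem_Collect_eq tau_conv
      by (intro conjI conv_closed f g osi_ideal_conv tau_closed)+
  qed blast
  moreover have "osi_relators n \<subseteq> ?J"
    using tau_relators[THEN subsetD[OF osi_relators_ideal]] osi_relators_carrier by blast
  ultimately show ?thesis
    using osi_ideal_minimal assms by blast
qed

lemma eta_cls:
  fixes f :: "gen list \<Rightarrow> 'k::field"
  shows "eta (cls n f) = cls n (tau f)"
proof -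
  have "tau ` (osi_ideal n :: (gen list \<Rightarrow> 'k) set) = osi_ideal n"
  proof
    show "(osi_ideal n :: (gen list \<Rightarrow> 'k) set) \<subseteq> tau ` osi_ideal n"
      using tau_ideal tau_tau by (metis image_eqI subsetI)
  qed (use tau_ideal in blast)
  moreover have "eta (cls n f) = (\<lambda>h w. h w + tau f w) ` tau ` osi_ideal n"
    unfolding eta_def cls_eq_image image_image tau_def ..
  ultimately show ?thesis by (simp add: cls_eq_image)
qed

lemma eta_eta:
  assumes "a \<in> carrier (osi_algebra K n)"
  shows "eta (eta a) = a"
  using assms by (auto simp: osi_algebra_simps eta_cls)

lemma eta_closed:
  assumes "a \<in> carrier (osi_algebra K n)"
  shows "eta a \<in> carrier (osi_algebra K n)"
  using assms by (auto simp: osi_algebra_simps eta_cls simp del: free_algebra_simps(1) intro!: imageI tau_closed)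

lemma eta_mult:
  assumes "a \<in> carrier (osi_algebra K n)" "b \<in> carrier (osi_algebra K n)"
  shows "eta (a \<otimes>\<^bsub>osi_algebra K n\<^esub> b) = eta b \<otimes>\<^bsub>osi_algebra K n\<^esub> eta a"
  using assms
  by (auto simp: osi_algebra_simps eta_cls osi_algebra_mult tau_closed tau_conv simp del: free_algebra_simps(1))

lemma eta_one: "eta \<one>\<^bsub>osi_algebra K n\<^esub> = \<one>\<^bsub>osi_algebra K n\<^esub>"
  by (simp add: osi_algebra_simps eta_cls tau_word)

lemma eta_zero: "eta \<zero>\<^bsub>osi_algebra K n\<^esub> = \<zero>\<^bsub>osi_algebra K n\<^esub>"
  by (simp add: osi_algebra_simps eta_cls tau_def)

section \<open>Polynomials and rational functions as representations\<close>

lemma update_eq_add_single: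
  "a \<notin> Poly_Mapping.keys f \<Longrightarrow> Poly_Mapping.update a b f = f + Poly_Mapping.single a b"
  by (intro poly_mapping_eqI)
    (auto simp: lookup_update lookup_add lookup_single when_def not_in_keys_iff_lookup_eq_zero)

lemma poly_mapping_add_induct [case_names zero single add]:
  assumes "P 0" "\<And>m c. P (Poly_Mapping.single m c)" "\<And>f g. P f \<Longrightarrow> P g \<Longrightarrow> P (f + g)"
  shows "P (f :: 'a \<Rightarrow>\<^sub>0 'b::comm_monoid_add)"
proof (induction f rule: update_induct)
  case (update f a b)
  then show ?case using assms(2,3) by (simp add: update_eq_add_single)
qed (rule assms(1))

text \<open>Monomials are given by lists of variable indices, matching words in the letters X or Y;
  \<open>expo\<close> forgets the order and keeps the exponent vector.\<close>

definition expo :: "nat list \<Rightarrow> (nat \<Rightarrow>\<^sub>0 nat)" where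
  "expo a = sum_list (map (\<lambda>i. Poly_Mapping.single i 1) a)"

lemma expo_simps [simp]:
  "expo [] = 0" "expo (i # a) = Poly_Mapping.single i 1 + expo a" "expo (a @ b) = expo a + expo b"
  by (simp_all add: expo_def)

lemma lookup_expo: "Poly_Mapping.lookup (expo a) i = count_list a i"
  by (induction a) (auto simp: lookup_add lookup_single)

lemma expo_eq_iff: "expo a = expo b \<longleftrightarrow> mset a = mset b"
  by (auto simp: poly_mapping_eq_iff fun_eq_iff lookup_expo multiset_eq_iff count_mset)

lemma keys_expo: "Poly_Mapping.keys (expo a) = set a"
  by (auto simp: in_keys_iff lookup_expo count_list_0_iff)

lemma expo_surj: obtains a where "expo a = m"
proof -
  have "finite {x. 0 < Poly_Mapping.lookup m x}" using finite_lookup[of m] by simp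
  then have "count (Abs_multiset (Poly_Mapping.lookup m)) = Poly_Mapping.lookup m"
    by (rule count_Abs_multiset)
  moreover obtain a where "mset a = Abs_multiset (Poly_Mapping.lookup m)" using ex_mset by blast
  ultimately have "expo a = m"
    by (intro poly_mapping_eqI) (simp add: lookup_expo count_mset[symmetric])
  then show ?thesis by (rule that)
qed

lemma inj_add_left: "inj (\<lambda>m. s + m :: 'a::cancel_semigroup_add)"
  by (simp add: inj_def)

text \<open>\<open>map_key (\<lambda>m. s + m)\<close> moves the coefficient at s + m to m: it
  divides by the monomial with exponent s and drops all terms not divisible by it.\<close>

lemma map_key_add_single: "Poly_Mapping.map_key (\<lambda>m. s + m) (Poly_Mapping.single (s + m) c) = Poly_Mapping.single (m :: nat \<Rightarrow>\<^sub>0 nat) c"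
  using map_key_single[OF inj_add_left, of s m c] .

lemma map_key_add_single_0:
  fixes m :: "nat \<Rightarrow>\<^sub>0 nat"
  assumes "\<And>k. m \<noteq> s + k"
  shows "Poly_Mapping.map_key (\<lambda>m. s + m) (Poly_Mapping.single m c) = 0"
  by (intro poly_mapping_eqI) (use assms in \<open>simp add: map_key.rep_eq[OF inj_add_left] lookup_single when_def\<close>)

lemma map_key_add_mult_single:
  fixes v :: "'k::field mpol"
  shows "Poly_Mapping.map_key (\<lambda>m. s + m) (Poly_Mapping.single s 1 * v) = v"
  by (induction v rule: poly_mapping_add_induct)
    (simp_all add: mult_single map_key_add_single distrib_left map_key_plus[OF inj_add_left] map_key_zero[OF inj_add_left])

text \<open>This is the relation between x_i and y_j. On a monomial divisible by x_j both sides
  multiply by x_i and divide by x_j. Otherwise multiplication by x_i, with i different from j, does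
  not create divisibility by x_j, and both sides vanish.\<close>

lemma map_key_add_mult_commute:
  fixes v :: "'k::field mpol"
  assumes "i \<noteq> j"
  shows "Poly_Mapping.single (Poly_Mapping.single i 1) 1 * Poly_Mapping.map_key (\<lambda>m. Poly_Mapping.single j 1 + m) v
    = Poly_Mapping.map_key (\<lambda>m. Poly_Mapping.single j 1 + m) (Poly_Mapping.single (Poly_Mapping.single i 1) 1 * v)"
proof (induction v rule: poly_mapping_add_induct)
  case (single m c)
  let ?i = "Poly_Mapping.single i 1 :: nat \<Rightarrow>\<^sub>0 nat" and ?j = "Poly_Mapping.single j 1 :: nat \<Rightarrow>\<^sub>0 nat"
  show ?case
  proof (cases "\<exists>k. m = ?j + k")
    case True
    then obtain k where "m = ?j + k" by blast
    moreover from this have "?i + m = ?j + (?i + k)" by (simp add: add.left_commute)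
    ultimately show ?thesis by (simp only: mult_single map_key_add_single)
  next
    case False
    have "?i + m \<noteq> ?j + k" for k
    proof
      assume eq: "?i + m = ?j + k"
      have "Poly_Mapping.lookup (?i + m) j = Poly_Mapping.lookup (?j + k) j" using eq by simp
      then have "Poly_Mapping.lookup m j > 0"
        using assms by (simp add: lookup_add lookup_single)
      then have "m = ?j + (m - ?j)"
        by (intro poly_mapping_eqI) (auto simp: lookup_add lookup_minus lookup_single when_def)
      with False show False by blast
    qed
    with False show ?thesis
      by (simp only: mult_single mult_1 map_key_add_single_0 mult_zero_right not_ex not_False_eq_True)
  qed
qed (simp_all add: distrib_left map_key_plus[OF inj_add_left] map_key_zero[OF inj_add_left])

text \<open>\<open>y\<^sub>i\<close> divides the monomials containing \<open>x\<^sub>i\<close> by \<open>x\<^sub>i\<close> and kills the others.\<close>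

fun act_poly :: "gen \<Rightarrow> 'k::field mpol \<Rightarrow> 'k mpol" where
  "act_poly (X i) v = Poly_Mapping.single (Poly_Mapping.single i 1) 1 * v"
| "act_poly (Y i) v = Poly_Mapping.map_key (\<lambda>m. Poly_Mapping.single i 1 + m) v"

text \<open>Here y_i acts as a two-sided inverse of x_i, so x_i y_i acts as 1 and the representation
  is not faithful; its value at 1 will be \<pi>.\<close>

fun act_rat :: "gen \<Rightarrow> 'k::field mpol fract \<Rightarrow> 'k mpol fract" where
  "act_rat (X i) v = ratfun_var TYPE('k) i * v"
| "act_rat (Y i) v = v / ratfun_var TYPE('k) i"

lemma ratfun_var_nonzero: "ratfun_var (K :: 'a::field itself) i \<noteq> 0"
proof -
  have "Poly_Mapping.single (Poly_Mapping.single i 1) 1 \<noteq> (0 :: 'a mpol)"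
    by (metis lookup_single_eq lookup_zero zero_neq_one)
  then show ?thesis by (simp add: ratfun_var_def Zero_fract_def eq_fract)
qed

interpretation poly_rep: free_rep "\<lambda>c. Poly_Mapping.single 0 c :: 'k::field mpol" act_poly
proof
  fix x :: gen and u v :: "'k mpol" and c :: 'k
  show "act_poly x (u + v) = act_poly x u + act_poly x v"
    by (cases x) (auto simp: distrib_left map_key_plus[OF inj_add_left])
  show "act_poly x (Poly_Mapping.single 0 c * v) = Poly_Mapping.single 0 c * act_poly x v"
  proof (cases x)
    case (X i)
    then show ?thesis by (simp add: mult.left_commute)
  next
    case (Y i)
    then show ?thesis by (simp add: mult_map_scale_conv_mult[symmetric] map_key_map[OF inj_add_left])
  qed
qed (simp_all add: single_add mult_single)

interpretation rat_rep: free_rep "\<lambda>c. Fract (Poly_Mapping.single 0 c) 1 :: 'k::field mpol fract" act_rat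
proof
  fix x :: gen and u v :: "'k mpol fract" and c :: 'k
  show "act_rat x (u + v) = act_rat x u + act_rat x v"
    by (cases x) (auto simp: distrib_left add_divide_distrib)
  show "act_rat x (Fract (Poly_Mapping.single 0 c) 1 * v) = Fract (Poly_Mapping.single 0 c) 1 * act_rat x v"
    by (cases x) (simp_all add: mult.left_commute)
qed (simp_all add: single_add mult_single One_fract_def)

lemma osi_ideal_kernel:
  fixes f :: "gen list \<Rightarrow> 'k::field" and \<iota> :: "'k \<Rightarrow> 'v::comm_ring_1"
  assumes "free_rep \<iota> act"
    and "\<And>i v. act (Y i) (act (X i) v) = v"
    and "\<And>i j v. i \<noteq> j \<Longrightarrow> act (X i) (act (Y j) v) = act (Y j) (act (X i) v)"
    and "\<And>i j v. act (X i) (act (X j) v) = act (X j) (act (X i) v)"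
    and "\<And>i j v. act (Y i) (act (Y j) v) = act (Y j) (act (Y i) v)"
    and "f \<in> osi_ideal n"
  shows "free_rep.rho \<iota> act f v = 0"
proof -
  interpret free_rep \<iota> act by fact
  have "rho r v = 0" if r: "r \<in> osi_relators n" for r :: "gen list \<Rightarrow> 'k" and v
    using r unfolding osi_relators_def
    by (elim UnE; clarsimp simp: rho_diff finite_supp_word rho_word assms(2-5))
  then have "osi_relators n \<subseteq> {f \<in> carrier (free_algebra (gens n)). \<forall>v. rho f v = 0}"
    using osi_relators_carrier by blast
  from osi_ideal_minimal[OF kernel_ideal this] assms(6) show ?thesis by blast
qed

lemma rho_poly_ideal: "f \<in> osi_ideal n \<Longrightarrow> poly_rep.rho f v = 0"
proof (rule osi_ideal_kernel)
  show "act_poly (Y i) (act_poly (Y j) v) = act_poly (Y j) (act_poly (Y i) v)" for i j and v :: "'a mpol"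
    by (simp add: map_key_compose[OF inj_add_left inj_add_left] o_def add.left_commute)
qed (simp_all add: poly_rep.free_rep_axioms map_key_add_mult_single
      map_key_add_mult_commute[simplified] mult.left_commute)

lemma rho_rat_ideal: "f \<in> osi_ideal n \<Longrightarrow> rat_rep.rho f v = 0"
  by (rule osi_ideal_kernel)
    (simp_all add: rat_rep.free_rep_axioms ratfun_var_nonzero mult.left_commute mult.commute)

lemma foldr_poly_X: "foldr act_poly (map X a) v = Poly_Mapping.single (expo a) 1 * v"
proof (induction a)
  case (Cons i a)
  have "Poly_Mapping.single (Poly_Mapping.single i 1) 1 * Poly_Mapping.single (expo a) 1
      = (Poly_Mapping.single (expo (i # a)) 1 :: 'a mpol)"
    by (simp add: mult_single)
  with Cons show ?case by (simp add: mult.assoc[symmetric])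
qed simp

lemma foldr_poly_Y: "foldr act_poly (map Y b) v = Poly_Mapping.map_key (\<lambda>m. expo b + m) v"
proof (induction b)
  case Nil
  then show ?case by (simp add: map_key_id)
next
  case (Cons i b)
  then show ?case
    by (simp add: map_key_compose[OF inj_add_left inj_add_left] o_def add.left_commute add.assoc)
qed

lemma foldr_rat_X: "foldr act_rat (map X a) v = Fract (Poly_Mapping.single (expo a) 1) 1 * v"
proof (induction a)
  case Nil
  then show ?case by (simp add: One_fract_def[symmetric])
next
  case (Cons i a)
  have "ratfun_var TYPE('a) i * Fract (Poly_Mapping.single (expo a) 1) 1 = (Fract (Poly_Mapping.single (expo (i # a)) 1) 1 :: 'a mpol fract)"
    by (simp add: ratfun_var_def mult_single)
  with Cons show ?case by (simp add: mult.assoc[symmetric])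
qed

lemma foldr_poly_Y_single:
  "foldr act_poly (map Y b) (Poly_Mapping.single (expo b) 1) = (1 :: 'k::field mpol)"
  using map_key_add_single[of "expo b" 0 1] by (simp add: foldr_poly_Y flip: single_one)

text \<open>If the monomial of b divided that of c, the length bound would force the quotient to be
  trivial and the two multisets to coincide.\<close>

lemma foldr_poly_Y_single_0:
  assumes "length b \<ge> length c" "mset b \<noteq> mset c"
  shows "foldr act_poly (map Y b) (Poly_Mapping.single (expo c) 1) = (0 :: 'k::field mpol)"
  unfolding foldr_poly_Y
proof (rule map_key_add_single_0)
  fix k
  obtain d where d: "expo d = k" by (rule expo_surj)
  show "expo c \<noteq> expo b + k"
  proof
    assume "expo c = expo b + k"
    then have eq: "mset c = mset b + mset d"
      unfolding d[symmetric] using expo_eq_iff[of c "b @ d"] by simp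
    then have "size (mset d) = 0" using assms(1) by (metis size_mset size_union add_le_same_cancel1 le_zero_eq)
    with eq assms(2) show False by simp
  qed
qed

section \<open>Normal forms and faithfulness\<close>

text \<open>Equality of two words in the quotient algebra, kept at the level of lists so that
  rewriting becomes list manipulation.\<close>

definition word_eqv :: "'k::field itself \<Rightarrow> nat \<Rightarrow> gen list \<Rightarrow> gen list \<Rightarrow> bool" where
  "word_eqv K n u v \<longleftrightarrow> u \<in> lists (gens n) \<and> v \<in> lists (gens n) \<and>
     word u - word v \<in> (osi_ideal n :: (gen list \<Rightarrow> 'k) set)"

lemma word_eqv_refl: "u \<in> lists (gens n) \<Longrightarrow> word_eqv K n u u"
  using osi_ideal_zero by (simp add: word_eqv_def fun_diff_def)

lemma word_eqv_sym:
  assumes "word_eqv (K :: 'k::field itself) n u v"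
  shows "word_eqv K n v u"
proof -
  have "word v - word u = (\<lambda>w. - 1 * (word u - word v :: gen list \<Rightarrow> 'k) w)"
    by (simp add: fun_eq_iff)
  with assms osi_ideal_smult[of "word u - word v :: gen list \<Rightarrow> 'k" n "-1"] show ?thesis
    unfolding word_eqv_def by simp
qed

lemma word_eqv_trans [trans]:
  assumes "word_eqv (K :: 'k::field itself) n u v" "word_eqv K n v w"
  shows "word_eqv K n u w"
proof -
  have "word u - word w = (\<lambda>x. (word u - word v) x + (word v - word w :: gen list \<Rightarrow> 'k) x)"
    by (simp add: fun_eq_iff)
  with assms osi_ideal_add[of "word u - word v :: gen list \<Rightarrow> 'k" n "word v - word w"] show ?thesis
    unfolding word_eqv_def by simp
qed

lemma word_eqv_context:
  assumes "word_eqv (K :: 'k::field itself) n u v" "p \<in> lists (gens n)" "q \<in> lists (gens n)"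
  shows "word_eqv K n (p @ u @ q) (p @ v @ q)"
proof -
  have p: "word p \<in> carrier (free_algebra (gens n) :: ('k, gen list \<Rightarrow> 'k) module)"
    and q: "word q \<in> carrier (free_algebra (gens n) :: ('k, gen list \<Rightarrow> 'k) module)"
    by (rule word_carrier, fact)+
  have i: "word u - word v \<in> (osi_ideal n :: (gen list \<Rightarrow> 'k) set)"
    using assms(1) by (simp add: word_eqv_def)
  have "conv (word p) (conv (word u - word v) (word q)) \<in> (osi_ideal n :: (gen list \<Rightarrow> 'k) set)"
    by (rule osi_ideal_conv(1)[OF osi_ideal_conv(2)[OF i q] p])
  then have "word (p @ u @ q) - word (p @ v @ q) \<in> (osi_ideal n :: (gen list \<Rightarrow> 'k) set)"
    by (simp add: conv_diff_left conv_diff_right conv_word)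
  with assms show ?thesis unfolding word_eqv_def by simp
qed

lemma word_eqv_append:
  assumes "word_eqv K n u v" "word_eqv K n u' v'"
  shows "word_eqv K n (u @ u') (v @ v')"
proof -
  have l: "v \<in> lists (gens n)" "u' \<in> lists (gens n)" using assms by (auto simp: word_eqv_def)
  have "word_eqv K n (u @ u') (v @ u')"
    using word_eqv_context[OF assms(1) _ l(2), of "[]"] by simp
  also have "word_eqv K n (v @ u') (v @ v')"
    using word_eqv_context[OF assms(2) l(1), of "[]"] by simp
  finally show ?thesis .
qed

lemma word_eqv_relations:
  assumes "i \<in> {1..n}" "j \<in> {1..n}"
  shows "word_eqv K n [Y i, X i] []"
    and "i \<noteq> j \<Longrightarrow> word_eqv K n [Y i, X j] [X j, Y i]"
    and "word_eqv K n [X i, X j] [X j, X i]"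
    and "word_eqv K n [Y i, Y j] [Y j, Y i]"
proof -
  have mem: "X i \<in> gens n" "Y i \<in> gens n" "X j \<in> gens n" "Y j \<in> gens n"
    using assms unfolding gens_def by blast+
  note I = osi_relatorsI[THEN subsetD[OF osi_relators_ideal]]
  show "word_eqv K n [Y i, X i] []"
    unfolding word_eqv_def using mem I(1)[OF assms(1)] by simp
  show "word_eqv K n [Y i, X j] [X j, Y i]" if "i \<noteq> j"
    by (rule word_eqv_sym) (unfold word_eqv_def, use mem that I(2)[OF assms(2,1)] in simp)
  show "word_eqv K n [X i, X j] [X j, X i]"
  proof (cases "i = j")
    case True
    with mem show ?thesis by (simp add: word_eqv_refl)
  next
    case False
    with mem I(3)[OF assms] show ?thesis unfolding word_eqv_def by simp
  qed
  show "word_eqv K n [Y i, Y j] [Y j, Y i]"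
  proof (cases "i = j")
    case True
    with mem show ?thesis by (simp add: word_eqv_refl)
  next
    case False
    with mem I(4)[OF assms] show ?thesis unfolding word_eqv_def by simp
  qed
qed

lemma word_eqv_move:
  assumes "g \<in> gens n" "\<And>h. h \<in> set p \<Longrightarrow> word_eqv K n [g, h] [h, g]"
  shows "word_eqv K n (g # p) (p @ [g])"
  using assms(2)
proof (induction p)
  case Nil
  then show ?case using assms(1) by (simp add: word_eqv_refl)
next
  case (Cons h p)
  have gh: "word_eqv K n [g, h] [h, g]" by (rule Cons.prems) simp
  have IH: "word_eqv K n (g # p) (p @ [g])" by (rule Cons.IH) (rule Cons.prems, simp)
  from IH have p: "p \<in> lists (gens n)" and h: "[h] \<in> lists (gens n)"
    using gh unfolding word_eqv_def by auto
  have "word_eqv K n ([g, h] @ p) ([h, g] @ p)"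
    using word_eqv_append[OF gh word_eqv_refl[OF p]] .
  also have "word_eqv K n ([h, g] @ p) ([h] @ (p @ [g]))"
    using word_eqv_append[OF word_eqv_refl[OF h] IH] by simp
  finally show ?case by simp
qed

text \<open>\<open>f\<close> stands for X or Y. The head i of a occurs in b as
  \<open>b1 @ i # b2\<close>; the induction hypothesis handles the rest against
  \<open>b1 @ b2\<close>, and \<open>word_eqv_move\<close> carries \<open>f i\<close> past
  b1.\<close>

lemma word_eqv_perm:
  assumes comm: "\<And>i j. i \<in> {1..n} \<Longrightarrow> j \<in> {1..n} \<Longrightarrow> word_eqv K n [f i, f j] [f j, f i]"
    and mem: "\<And>i. i \<in> {1..n} \<Longrightarrow> f i \<in> gens n"
    and "mset a = mset b" "set a \<subseteq> {1..n}"
  shows "word_eqv K n (map f a) (map f b)"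
  using assms(3,4)
proof (induction a arbitrary: b)
  case Nil
  then show ?case by (simp add: word_eqv_refl)
next
  case (Cons i a)
  have "i \<in> set b" using Cons.prems(1) by (metis list.set_intros(1) mset_eq_setD)
  then obtain b1 b2 where b: "b = b1 @ i # b2" by (meson split_list)
  have sb: "set b \<subseteq> {1..n}" using Cons.prems by (metis mset_eq_setD)
  have i: "i \<in> {1..n}" using Cons.prems(2) by simp
  have fi: "[f i] \<in> lists (gens n)" using mem[OF i] by simp
  have l2: "map f b2 \<in> lists (gens n)" using sb mem unfolding b in_lists_conv_set by auto
  have "word_eqv K n (map f a) (map f (b1 @ b2))"
    by (rule Cons.IH) (use Cons.prems in \<open>simp_all add: b\<close>)
  from word_eqv_append[OF word_eqv_refl[OF fi] this]
  have "word_eqv K n (map f (i # a)) ((f i # map f b1) @ map f b2)" by simp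
  also have "word_eqv K n \<dots> ((map f b1 @ [f i]) @ map f b2)"
  proof (rule word_eqv_append[OF word_eqv_move word_eqv_refl[OF l2]])
    show "f i \<in> gens n" by (rule mem[OF i])
    fix h assume "h \<in> set (map f b1)"
    then obtain j where "j \<in> set b1" "h = f j" by auto
    with sb show "word_eqv K n [f i, h] [h, f i]" using comm[OF i, of j] by (auto simp: b)
  qed
  finally show ?case by (simp add: b)
qed

definition normal_word :: "nat list \<times> nat list \<Rightarrow> gen list" where
  "normal_word p = map X (fst p) @ map Y (snd p)"

lemma map_gens_lists:
  assumes "set a \<subseteq> {1..n}"
  shows "map X a \<in> lists (gens n)" "map Y a \<in> lists (gens n)"
  using assms unfolding gens_def in_lists_conv_set by auto

text \<open>A new first letter x_i joins the x-block. A new first letter y_i travels to the right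
  through the x-block until it either cancels against an x_i or arrives at the y-block.\<close>

lemma normal_form_ex:
  assumes "w \<in> lists (gens n)"
  shows "\<exists>a b. set a \<subseteq> {1..n} \<and> set b \<subseteq> {1..n} \<and> word_eqv K n w (map X a @ map Y b)"
  using assms
proof (induction w)
  case Nil
  show ?case by (intro exI[of _ "[]"]) (simp add: word_eqv_refl)
next
  case (Cons g w)
  then obtain a b where ab: "set a \<subseteq> {1..n}" "set b \<subseteq> {1..n}"
    "word_eqv K n w (map X a @ map Y b)" by auto
  note lY = map_gens_lists(2)[OF ab(2)]
  have g: "g \<in> gens n" "[g] \<in> lists (gens n)" using Cons.hyps by auto
  have gw: "word_eqv K n (g # w) (g # (map X a @ map Y b))"
    using word_eqv_append[OF word_eqv_refl[OF g(2)] ab(3)] by simp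
  show ?case
  proof (cases g)
    case (X i)
    then have "i \<in> {1..n}" using g by (auto simp: gens_def)
    with gw ab X show ?thesis
      by (intro exI[of _ "i # a"] exI[of _ b]) simp
  next
    case (Y i)
    then have i: "i \<in> {1..n}" using g by (auto simp: gens_def)
    have move: "word_eqv K n (g # map X c) (map X c @ [g])" if "set c \<subseteq> {1..n}" "i \<notin> set c" for c
    proof (rule word_eqv_move[OF g(1)])
      fix h assume "h \<in> set (map X c)"
      then obtain j where "j \<in> set c" "h = X j" by auto
      with that i show "word_eqv K n [g, h] [h, g]"
        unfolding Y by (auto intro!: word_eqv_relations(2) simp del: atLeastAtMost_iff)
    qed
    show ?thesis
    proof (cases "i \<in> set a")
      case False
      have "word_eqv K n (g # (map X a @ map Y b)) ((map X a @ [g]) @ map Y b)"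
        using word_eqv_append[OF move[OF ab(1) False] word_eqv_refl[OF lY]] by simp
      from word_eqv_trans[OF gw this] show ?thesis
        using ab i Y by (intro exI[of _ a] exI[of _ "i # b"]) simp
    next
      case True
      \<comment> \<open>The first occurrence of i is taken, so that y_i only has to pass letters x_j
        with j different from i before it cancels.\<close>
      then obtain a1 a2 where a: "a = a1 @ i # a2" "i \<notin> set a1" by (meson split_list_first)
      have sub: "set a1 \<subseteq> {1..n}" "set a2 \<subseteq> {1..n}" using ab a by auto
      have l1: "map X a1 \<in> lists (gens n)" "map X a2 \<in> lists (gens n)" "[X i] \<in> lists (gens n)"
        using map_gens_lists(1)[OF sub(1)] map_gens_lists(1)[OF sub(2)] map_gens_lists(1)[of "[i]" n] i
        by auto
      have l2: "X i # map X a2 @ map Y b \<in> lists (gens n)" using l1 lY by simp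
      have l3: "map X a2 @ map Y b \<in> lists (gens n)" using l1 lY by simp
      have "word_eqv K n ((g # map X a1) @ (X i # map X a2 @ map Y b)) ((map X a1 @ [g]) @ (X i # map X a2 @ map Y b))"
        using word_eqv_append[OF move[OF sub(1) a(2)] word_eqv_refl[OF l2]] .
      also have "word_eqv K n ((map X a1 @ [g]) @ (X i # map X a2 @ map Y b)) (map X a1 @ map X a2 @ map Y b)"
        using word_eqv_context[OF word_eqv_relations(1)[OF i i] l1(1) l3] Y by simp
      finally have "word_eqv K n (g # (map X a @ map Y b)) (map X (a1 @ a2) @ map Y b)"
        using Y a by simp
      from word_eqv_trans[OF gw this] show ?thesis
        using ab sub by (intro exI[of _ "a1 @ a2"] exI[of _ b]) simp
    qed
  qed
qed

text \<open>Sorted lists are determined by their multisets, so different pairs of sorted lists give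
  different pairs of exponent vectors.\<close>

lemma sorted_normal_form_ex:
  assumes "w \<in> lists (gens n)"
  shows "\<exists>p. sorted (fst p) \<and> sorted (snd p) \<and> word_eqv K n w (normal_word p)"
proof -
  obtain a b where ab: "set a \<subseteq> {1..n}" "set b \<subseteq> {1..n}" "word_eqv K n w (map X a @ map Y b)"
    using normal_form_ex[OF assms] by blast
  note ab(3)
  also have "word_eqv K n (map X a @ map Y b) (map X (sort a) @ map Y (sort b))"
  proof (rule word_eqv_append; rule word_eqv_perm)
    show "set a \<subseteq> {1..n}" "set b \<subseteq> {1..n}" by fact+
  qed (auto simp: word_eqv_relations gens_def simp del: atLeastAtMost_iff)
  finally show ?thesis
    by (intro exI[of _ "(sort a, sort b)"]) (simp add: normal_word_def)
qed

section \<open>Faithfulness of the polynomial representation\<close>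

lemma rho_poly_eqv:
  assumes "word_eqv (K :: 'k::field itself) n u v"
  shows "foldr act_poly u (x :: 'k mpol) = foldr act_poly v x"
proof -
  have "poly_rep.rho (word u - word v :: gen list \<Rightarrow> 'k) x = 0"
    using assms by (intro rho_poly_ideal[of _ n]) (simp add: word_eqv_def)
  then show ?thesis by (simp add: poly_rep.rho_diff finite_supp_word poly_rep.rho_word)
qed

lemma osi_ideal_sum: "(\<And>i. i \<in> A \<Longrightarrow> f i \<in> osi_ideal n) \<Longrightarrow> (\<lambda>w. \<Sum>i\<in>A. f i w) \<in> osi_ideal n"
proof (induction A rule: infinite_finite_induct)
  case (insert i A)
  then have "(\<lambda>w. f i w + (\<Sum>i\<in>A. f i w)) \<in> osi_ideal n"
    by (intro osi_ideal_add) auto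
  with insert.hyps show ?case by simp
qed (simp_all add: osi_ideal_zero)

text \<open>The triangularity behind faithfulness: on the monomial x^b, a normal word whose y-part
  has at least the degree of b survives only if its y-part is exactly b.\<close>

lemma normal_word_act_single:
  fixes p q :: "nat list \<times> nat list"
  assumes "length (snd q) \<le> length (snd p)" "sorted (snd p)" "sorted (snd q)"
  shows "foldr act_poly (normal_word p) (Poly_Mapping.single (expo (snd q)) 1)
    = (if snd p = snd q then Poly_Mapping.single (expo (fst p)) 1 else (0 :: 'k::field mpol))"
proof (cases "snd p = snd q")
  case True
  then show ?thesis by (simp add: normal_word_def foldr_poly_X foldr_poly_Y_single)
next
  case False
  then have "mset (snd p) \<noteq> mset (snd q)"
    using assms by (metis properties_for_sort)
  with False show ?thesis
    by (simp add: normal_word_def foldr_poly_X foldr_poly_Y_single_0[OF assms(1)])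
qed

text \<open>Among the normal words \<open>x\<^sup>a y\<^sup>b\<close> of \<open>f\<close> choose one whose \<open>b\<close> has minimal degree; on the monomial
  \<open>x\<^sup>b\<close> only the terms with this very \<open>b\<close> survive, and they give distinct monomials \<open>x\<^sup>a\<close>.\<close>

theorem poly_rep_faithful:
  fixes f :: "gen list \<Rightarrow> 'k::field"
  assumes f: "f \<in> carrier (free_algebra (gens n))" and zero: "\<And>v. poly_rep.rho f v = 0"
  shows "f \<in> osi_ideal n"
proof -
  have fin: "finite (supp f)" and lists: "supp f \<subseteq> lists (gens n)"
    using f unfolding free_algebra_simps(1) by (rule conjunct1, rule conjunct2)
  have "\<forall>w \<in> lists (gens n). \<exists>p. sorted (fst p) \<and> sorted (snd p) \<and> word_eqv TYPE('k) n w (normal_word p)"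
    using sorted_normal_form_ex by blast
  then obtain N where N: "\<And>w. w \<in> lists (gens n) \<Longrightarrow>
      sorted (fst (N w)) \<and> sorted (snd (N w)) \<and> word_eqv TYPE('k) n w (normal_word (N w))"
    by metis
  \<comment> \<open>Several words of f may share a normal form; \<open>c p\<close> is the total
    coefficient of the normal form p.\<close>
  define c where "c p = (\<Sum>w\<in>{w \<in> supp f. N w = p}. f w)" for p
  \<comment> \<open>Stated for an arbitrary additive h because it is needed twice: for the action on
    a monomial and for the coefficients of f itself.\<close>
  have group: "(\<Sum>w\<in>supp f. h (f w) (N w)) = (\<Sum>p\<in>N ` supp f. h (c p) p)"
    if "\<And>p. h 0 p = 0" "\<And>a b p. h (a + b) p = h a p + h b p" for h :: "'k \<Rightarrow> nat list \<times> nat list \<Rightarrow> 'c::comm_monoid_add"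
  proof -
    have hsum: "(\<Sum>w\<in>A. h (f w) p) = h (\<Sum>w\<in>A. f w) p" for A p
      by (induction A rule: infinite_finite_induct) (simp_all add: that)
    have "(\<Sum>w\<in>supp f. h (f w) (N w)) = (\<Sum>p\<in>N ` supp f. \<Sum>w\<in>{w \<in> supp f. N w = p}. h (f w) (N w))"
      by (rule sum.image_gen[OF fin])
    also have "\<dots> = (\<Sum>p\<in>N ` supp f. h (c p) p)"
      unfolding c_def hsum[symmetric] by (intro sum.cong refl) auto
    finally show ?thesis .
  qed
  have c0: "c p = 0" if "p \<in> N ` supp f" for p
  proof (rule ccontr)
    assume "c p \<noteq> 0"
    define B where "B = {p \<in> N ` supp f. c p \<noteq> 0}"
    have "p \<in> B" using that \<open>c p \<noteq> 0\<close> by (simp add: B_def)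
    then obtain q where q: "q \<in> B" and min: "\<And>p. p \<in> B \<Longrightarrow> length (snd q) \<le> length (snd p)"
      using ex_has_least_nat[of "\<lambda>p. p \<in> B" p "\<lambda>p. length (snd p)"] by blast
    have sortedB: "sorted (fst p) \<and> sorted (snd p)" if "p \<in> B" for p
      using that N lists unfolding B_def by blast
    let ?v = "Poly_Mapping.single (expo (snd q)) 1 :: 'k mpol"
    let ?h = "\<lambda>a p. Poly_Mapping.single 0 a * foldr act_poly (normal_word p) ?v"
    have "0 = poly_rep.rho f ?v" by (simp add: zero)
    also have "\<dots> = (\<Sum>w\<in>supp f. ?h (f w) (N w))"
      unfolding poly_rep.rho_def poly_rep.lin_def
    proof (intro sum.cong refl)
      fix w assume "w \<in> supp f"
      then have "word_eqv TYPE('k) n w (normal_word (N w))" using N lists by blast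
      then show "Poly_Mapping.single 0 (f w) * foldr act_poly w ?v = ?h (f w) (N w)"
        by (simp only: rho_poly_eqv)
    qed
    also have "\<dots> = (\<Sum>p\<in>N ` supp f. ?h (c p) p)"
      by (rule group) (simp_all add: single_add distrib_right)
    also have "\<dots> = (\<Sum>p\<in>B. ?h (c p) p)"
      by (rule sum.mono_neutral_right) (use fin in \<open>auto simp: B_def\<close>)
    also have "\<dots> = (\<Sum>p\<in>B. if snd p = snd q then Poly_Mapping.single (expo (fst p)) (c p) else 0)"
    proof (intro sum.cong refl)
      fix p assume p: "p \<in> B"
      show "?h (c p) p = (if snd p = snd q then Poly_Mapping.single (expo (fst p)) (c p) else 0)"
      proof -
        have "foldr act_poly (normal_word p) ?v
            = (if snd p = snd q then Poly_Mapping.single (expo (fst p)) 1 else 0)"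
          using normal_word_act_single[OF min[OF p]] sortedB[OF p] sortedB[OF q] by blast
        then show ?thesis by (simp add: mult_single)
      qed
    qed
    \<comment> \<open>The terms left share the y-part of q, so their x-parts are pairwise different
      monomials; the coefficient at the x-part of q isolates \<open>c q\<close>.\<close>
    finally have "0 = Poly_Mapping.lookup (\<Sum>p\<in>B. if snd p = snd q then Poly_Mapping.single (expo (fst p)) (c p) else 0) (expo (fst q))"
      by simp
    also have "\<dots> = (\<Sum>p\<in>B. if p = q then c p else 0)"
      unfolding lookup_sum
    proof (intro sum.cong refl)
      fix p assume p: "p \<in> B"
      have "expo (fst p) = expo (fst q) \<longleftrightarrow> fst p = fst q"
        using sortedB[OF p] sortedB[OF q] unfolding expo_eq_iff by (metis properties_for_sort sorted_sort_id)
      then show "Poly_Mapping.lookup (if snd p = snd q then Poly_Mapping.single (expo (fst p)) (c p) else 0) (expo (fst q))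
          = (if p = q then c p else 0)"
        by (auto simp: lookup_single prod_eq_iff)
    qed
    also have "\<dots> = c q"
    proof -
      have "finite B" using fin by (simp add: B_def)
      with q show ?thesis by simp
    qed
    finally show False using q by (simp add: B_def)
  qed
  \<comment> \<open>Since all \<open>c p\<close> vanish, the normal forms cancel in total. So f
    equals the combination of the differences between its words and their normal forms, each of
    which lies in the ideal.\<close>
  have "f = (\<lambda>x. \<Sum>w\<in>supp f. f w * (word w x - word (normal_word (N w)) x))"
  proof
    fix x
    have "(\<Sum>w\<in>supp f. f w * word (normal_word (N w)) x) = (\<Sum>p\<in>N ` supp f. c p * word (normal_word p) x)"
      by (rule group) (simp_all add: distrib_right)
    also have "\<dots> = 0" using c0 by simp
    finally have "(\<Sum>w\<in>supp f. f w * (word w x - word (normal_word (N w)) x)) = (\<Sum>w\<in>supp f. f w * word w x)"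
      by (simp add: right_diff_distrib sum_subtractf)
    also have "\<dots> = (\<Sum>w\<in>supp f. if w = x then f w else 0)"
      by (intro sum.cong refl) (auto simp: word_def)
    also have "\<dots> = f x" using fin by simp
    finally show "f x = (\<Sum>w\<in>supp f. f w * (word w x - word (normal_word (N w)) x))" by simp
  qed
  also have "\<dots> \<in> osi_ideal n"
  proof (rule osi_ideal_sum)
    fix w assume "w \<in> supp f"
    then have "word_eqv TYPE('k) n w (normal_word (N w))" using N lists by blast
    then have "word w - word (normal_word (N w)) \<in> (osi_ideal n :: (gen list \<Rightarrow> 'k) set)"
      by (simp add: word_eqv_def)
    from osi_ideal_smult[OF this, of "f w"]
    show "(\<lambda>x. f w * (word w x - word (normal_word (N w)) x)) \<in> osi_ideal n" by simp
  qed
  finally show ?thesis .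
qed

section \<open>Elements acting as polynomials\<close>

lemma polys_upto_intros:
  "0 \<in> polys_upto n"
  "p \<in> polys_upto n \<Longrightarrow> q \<in> polys_upto n \<Longrightarrow> p + q \<in> polys_upto n"
  "p \<in> polys_upto n \<Longrightarrow> q \<in> polys_upto n \<Longrightarrow> p * q \<in> polys_upto n"
  "Poly_Mapping.keys m \<subseteq> {1..n} \<Longrightarrow> Poly_Mapping.single m c \<in> polys_upto n"
proof -
  show "0 \<in> polys_upto n" by (simp add: polys_upto_def)
  show "Poly_Mapping.single m c \<in> polys_upto n" if "Poly_Mapping.keys m \<subseteq> {1..n}"
    using that by (cases "c = 0") (auto simp: polys_upto_def)
  show "p + q \<in> polys_upto n" if "p \<in> polys_upto n" "q \<in> polys_upto n"
    using that keys_add[of p q] unfolding polys_upto_def by blast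
  show "p * q \<in> polys_upto n" if pq: "p \<in> polys_upto n" "q \<in> polys_upto n"
    unfolding polys_upto_def
  proof (intro CollectI ballI)
    fix m assume "m \<in> Poly_Mapping.keys (p * q)"
    then obtain a b where ab: "a \<in> Poly_Mapping.keys p" "b \<in> Poly_Mapping.keys q" "m = a + b"
      using keys_mult[of p q] by blast
    then have "Poly_Mapping.keys a \<subseteq> {1..n}" "Poly_Mapping.keys b \<subseteq> {1..n}"
      using pq unfolding polys_upto_def by blast+
    then show "Poly_Mapping.keys m \<subseteq> {1..n}"
      unfolding ab(3) using keys_add[of a b] by blast
  qed
qed

lemma conv_smult_left: "conv (\<lambda>w. c * f w) g = (\<lambda>w. c * conv f g w)"
  by (simp add: conv_def sum_distrib_left mult.assoc)

text \<open>Every letter acts on the field by a multiplication, hence so does f. This is what makes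
  the value of \<open>rat_rep.rho f\<close> at 1 multiplicative in f.\<close>

lemma rho_rat_scale: "rat_rep.rho f v = rat_rep.rho f 1 * v"
proof -
  have "foldr act_rat w v = foldr act_rat w 1 * v" for w
  proof (induction w)
    case (Cons g w)
    then show ?case by (cases g) (simp_all add: mult.assoc)
  qed simp
  then show ?thesis
    by (simp add: rat_rep.rho_def rat_rep.lin_def sum_distrib_right mult.assoc)
qed

text \<open>The value in the field is carried along as a separate condition; by faithfulness the polynomial
  representation determines it, but this need not be shown.\<close>

definition acts_as :: "nat \<Rightarrow> (gen list \<Rightarrow> 'k::field) \<Rightarrow> 'k mpol \<Rightarrow> bool" where
  "acts_as n f p \<longleftrightarrow> f \<in> carrier (free_algebra (gens n)) \<and> p \<in> polys_upto n \<and>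
     (\<forall>v. poly_rep.rho f v = p * v) \<and> rat_rep.rho f 1 = Fract p 1"

lemma acts_asD:
  assumes "acts_as n f p"
  shows "f \<in> carrier (free_algebra (gens n))" "p \<in> polys_upto n"
    "poly_rep.rho f v = p * v" "rat_rep.rho f 1 = Fract p 1" "finite (supp f)"
  using assms free_algebra_finite[of f "gens n"] unfolding acts_as_def by blast+

lemma acts_as_zero: "acts_as n (\<lambda>w. 0) 0"
  unfolding acts_as_def
  by (simp add: polys_upto_intros poly_rep.rho_zero rat_rep.rho_zero Zero_fract_def)

lemma acts_as_add:
  assumes "acts_as n f p" "acts_as n g q"
  shows "acts_as n (\<lambda>w. f w + g w) (p + q)"
  unfolding acts_as_def
proof (intro conjI allI)
  note f = acts_asD[OF assms(1)] and g = acts_asD[OF assms(2)]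
  show "(\<lambda>w. f w + g w) \<in> carrier (free_algebra (gens n))" by (rule add_free_algebra_closed[OF f(1) g(1)])
  show "p + q \<in> polys_upto n" by (rule polys_upto_intros(2)[OF f(2) g(2)])
  show "poly_rep.rho (\<lambda>w. f w + g w) v = (p + q) * v" for v
    by (simp add: poly_rep.rho_add[OF f(5) g(5)] f(3) g(3) distrib_right)
  show "rat_rep.rho (\<lambda>w. f w + g w) 1 = Fract (p + q) 1"
    by (simp add: rat_rep.rho_add[OF f(5) g(5)] f(4) g(4))
qed

lemma acts_as_conv:
  assumes "acts_as n f p" "acts_as n g q"
  shows "acts_as n (conv f g) (p * q)"
  unfolding acts_as_def
proof (intro conjI allI)
  note f = acts_asD[OF assms(1)] and g = acts_asD[OF assms(2)]
  show "conv f g \<in> carrier (free_algebra (gens n))" by (rule conv_closed[OF f(1) g(1)])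
  show "p * q \<in> polys_upto n" by (rule polys_upto_intros(3)[OF f(2) g(2)])
  show "poly_rep.rho (conv f g) v = (p * q) * v" for v
    by (simp add: poly_rep.rho_conv[OF f(5) g(5)] f(3) g(3) mult.assoc)
  show "rat_rep.rho (conv f g) 1 = Fract (p * q) 1"
    using rat_rep.rho_conv[OF f(5) g(5), of 1] rho_rat_scale[of f "rat_rep.rho g 1"] f(4) g(4) by simp
qed

lemma acts_as_smult:
  assumes "acts_as n f p"
  shows "acts_as n (\<lambda>w. c * f w) (Poly_Mapping.single 0 c * p)"
  unfolding acts_as_def
proof (intro conjI allI)
  note f = acts_asD[OF assms(1)]
  show "(\<lambda>w. c * f w) \<in> carrier (free_algebra (gens n))" by (rule smult_free_algebra_closed[OF f(1)])
  show "Poly_Mapping.single 0 c * p \<in> polys_upto n" by (intro polys_upto_intros f(2)) simp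
  show "poly_rep.rho (\<lambda>w. c * f w) v = Poly_Mapping.single 0 c * p * v" for v
    by (simp add: poly_rep.rho_smult f(3) mult.assoc)
  show "rat_rep.rho (\<lambda>w. c * f w) 1 = Fract (Poly_Mapping.single 0 c * p) 1"
    by (simp add: rat_rep.rho_smult f(4))
qed

lemma acts_as_X:
  assumes "set a \<subseteq> {1..n}"
  shows "acts_as n (word (map X a)) (Poly_Mapping.single (expo a) 1)"
  unfolding acts_as_def
proof (intro conjI allI)
  show "word (map X a) \<in> carrier (free_algebra (gens n))"
    by (rule word_carrier) (rule map_gens_lists(1)[OF assms])
  show "Poly_Mapping.single (expo a) 1 \<in> polys_upto n"
    by (rule polys_upto_intros(4)) (simp only: keys_expo assms)
qed (simp_all add: poly_rep.rho_word rat_rep.rho_word foldr_poly_X foldr_rat_X)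

text \<open>Needed for surjectivity: every polynomial in x_1,...,x_n is the value of an element of
  P.\<close>

lemma acts_as_ex:
  assumes "p \<in> polys_upto n"
  shows "\<exists>f. acts_as n f p"
  using assms
proof (induction p rule: update_induct)
  case const
  show ?case using acts_as_zero by blast
next
  case (update f a b)
  have k: "Poly_Mapping.keys (Poly_Mapping.update a b f) = insert a (Poly_Mapping.keys f)"
    using update.hyps by (simp add: keys_update)
  then have "f \<in> polys_upto n" and a: "Poly_Mapping.keys a \<subseteq> {1..n}"
    using update.prems unfolding polys_upto_def by simp_all
  then obtain g where g: "acts_as n g f" using update.IH by blast
  obtain l where l: "expo l = a" by (rule expo_surj)
  with a have "set l \<subseteq> {1..n}" by (simp add: keys_expo[symmetric])
  from acts_as_add[OF g acts_as_smult[OF acts_as_X[OF this], of b]]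
  have "\<exists>h. acts_as n h (f + Poly_Mapping.single a b)"
    by (auto simp: l mult_single)
  then show ?case by (simp only: update_eq_add_single[OF update.hyps(1)])
qed

text \<open>For products that are not visibly polynomials in the x_i but act like one already known
  to be attained.\<close>

lemma acts_as_unique:
  assumes "f \<in> carrier (free_algebra (gens n))" "acts_as n g p"
    "\<And>v. poly_rep.rho f v = p * v" "rat_rep.rho f 1 = Fract p 1"
  shows "acts_as n f p"
  using assms acts_asD(2)[OF assms(2)] unfolding acts_as_def by blast

text \<open>Induction on the word. A new letter x_i in front multiplies the numerator and keeps g.
  For a new y_i the denominator becomes g x_i: the numerator p turns into p x_i, and y_i divides it
  back to p exactly.\<close>

lemma word_right_denominator:
  fixes v :: "gen list"
  assumes "v \<in> lists (gens n)"
  shows "\<exists>g p q. acts_as n g (q :: 'k::field mpol) \<and> q \<noteq> 0 \<and> acts_as n (conv (word v) g) p"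
  using assms
proof (induction v)
  case Nil
  have "acts_as n (word []) (1 :: 'k mpol)" using acts_as_X[of "[]" n] by simp
  then show ?case by (metis conv_one_left zero_neq_one)
next
  case (Cons x v)
  then obtain g p and q :: "'k mpol" where g: "acts_as n g q" "q \<noteq> 0" "acts_as n (conv (word v) g) p"
    by blast
  note f = acts_asD[OF g(1)] and vg = acts_asD[OF g(3)]
  have x: "x \<in> gens n" using Cons by simp
  note fin = finite_supp_word[where 'b = 'k and 'a = gen]
  have split: "conv (word (x # v)) h = conv (word [x]) (conv (word v) h)"
    if "finite (supp h)" for h :: "gen list \<Rightarrow> 'k"
    using conv_assoc[OF fin fin that, of "[x]" v] by (simp add: conv_word)
  show ?case
  proof (cases x)
    case (X i)
    then have "acts_as n (word [x]) (Poly_Mapping.single (expo [i]) (1::'k))"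
      using x acts_as_X[of "[i]" n] by (auto simp: gens_def)
    from acts_as_conv[OF this g(3)] show ?thesis
      unfolding split[OF f(5), symmetric] using g by blast
  next
    case (Y i)
    then have i: "i \<in> {1..n}" using x by (auto simp: gens_def)
    let ?x = "Poly_Mapping.single (expo [i]) 1 :: 'k mpol"
    have X: "acts_as n (word [X i]) ?x" using i acts_as_X[of "[i]" n] by simp
    note X' = acts_asD[OF X]
    have gx: "acts_as n (conv g (word [X i])) (q * ?x)"
      by (rule acts_as_conv[OF g(1) X])
    have vgx: "acts_as n (conv (word v) (conv g (word [X i]))) (p * ?x)"
      using acts_as_conv[OF g(3) X] by (simp only: conv_assoc[OF fin f(5) fin])
    have "acts_as n (conv (word (x # v)) (conv g (word [X i]))) p"
    proof (rule acts_as_unique[OF _ g(3)])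
      show "conv (word (x # v)) (conv g (word [X i])) \<in> carrier (free_algebra (gens n))"
        unfolding split[OF acts_asD(5)[OF gx]]
        by (intro conv_closed word_carrier acts_asD(1)[OF vgx]) (use x in simp)
      show "poly_rep.rho (conv (word (x # v)) (conv g (word [X i]))) u = p * u" for u
        unfolding split[OF acts_asD(5)[OF gx]]
        using map_key_add_mult_single[of "Poly_Mapping.single i 1" "p * u"]
        by (simp add: poly_rep.rho_conv[OF fin acts_asD(5)[OF vgx]] poly_rep.rho_word acts_asD(3)[OF vgx] Y mult_ac)
      show "rat_rep.rho (conv (word (x # v)) (conv g (word [X i]))) 1 = Fract p 1"
      proof -
        have "Fract (p * ?x) 1 = Fract p 1 * ratfun_var TYPE('k) i" by (simp add: ratfun_var_def)
        then show ?thesis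
          unfolding split[OF acts_asD(5)[OF gx]]
          by (simp add: rat_rep.rho_conv[OF fin acts_asD(5)[OF vgx]] rat_rep.rho_word acts_asD(4)[OF vgx] Y ratfun_var_nonzero
              del: mult_fract)
      qed
    qed
    moreover have "q * ?x \<noteq> 0"
    proof -
      have "?x \<noteq> 0" by (metis lookup_single_eq lookup_zero zero_neq_one)
      with g(2) show ?thesis by simp
    qed
    ultimately show ?thesis using gx by blast
  qed
qed

lemma right_denominator:
  fixes f :: "gen list \<Rightarrow> 'k::field"
  assumes "f \<in> carrier (free_algebra (gens n))"
  shows "\<exists>g p q. acts_as n g q \<and> q \<noteq> 0 \<and> acts_as n (conv f g) p"
  using assms
proof (induction f rule: free_algebra_induct)
  case zero
  have "acts_as n (word []) (1 :: 'k mpol)" using acts_as_X[of "[]" n] by simp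
  moreover have "conv (\<lambda>w. 0) (word ([] :: gen list)) = (\<lambda>w. 0 :: 'k)" by (simp add: conv_def)
  ultimately have "acts_as n (word []) (1 :: 'k mpol) \<and> (1 :: 'k mpol) \<noteq> 0 \<and>
      acts_as n (conv (\<lambda>w. 0) (word [])) (0 :: 'k mpol)"
    by (simp add: acts_as_zero)
  then show ?case by blast
next
  case (add f1 f2)
  from add.IH obtain g1 p1 q1 g2 p2 q2 where
    1: "acts_as n g1 q1" "q1 \<noteq> 0" "acts_as n (conv f1 g1) p1" and
    2: "acts_as n g2 q2" "q2 \<noteq> 0" "acts_as n (conv f2 g2) p2" by blast
  note f1 = free_algebra_finite[OF add.hyps(1)] and f2 = free_algebra_finite[OF add.hyps(2)]
  note g1 = acts_asD[OF 1(1)] and g2 = acts_asD[OF 2(1)]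
  have g: "acts_as n (conv g1 g2) (q1 * q2)" by (rule acts_as_conv[OF 1(1) 2(1)])
  have s1: "acts_as n (conv f1 (conv g1 g2)) (p1 * q2)"
    using acts_as_conv[OF 1(3) 2(1)] by (simp only: conv_assoc[OF f1 g1(5) g2(5)])
  \<comment> \<open>For a sum, g1 g2 is the common denominator, but in f2 g1 g2 the factor g1
    separates f2 from g2. Since g1 and g2 act by commuting polynomials, this product acts like f2 g2
    g1.\<close>
  have s2: "acts_as n (conv f2 (conv g1 g2)) (p2 * q1)"
  proof (rule acts_as_unique[OF _ acts_as_conv[OF 2(3) 1(1)]])
    show "conv f2 (conv g1 g2) \<in> carrier (free_algebra (gens n))"
      by (rule conv_closed[OF add.hyps(2) acts_asD(1)[OF g]])
    show "poly_rep.rho (conv f2 (conv g1 g2)) v = p2 * q1 * v" for v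
    proof -
      have "poly_rep.rho (conv f2 (conv g1 g2)) v = poly_rep.rho f2 (poly_rep.rho g2 (q1 * v))"
        by (simp add: poly_rep.rho_conv[OF f2 acts_asD(5)[OF g]] acts_asD(3)[OF g] g2(3) mult_ac)
      also have "\<dots> = poly_rep.rho (conv f2 g2) (q1 * v)"
        by (simp add: poly_rep.rho_conv[OF f2 g2(5)])
      also have "\<dots> = p2 * q1 * v" by (simp add: acts_asD(3)[OF 2(3)] mult.assoc)
      finally show ?thesis .
    qed
    have "rat_rep.rho (conv f2 (conv g1 g2)) 1 = rat_rep.rho f2 (Fract (q1 * q2) 1)"
      by (simp only: rat_rep.rho_conv[OF f2 acts_asD(5)[OF g]] acts_asD(4)[OF g])
    also have "\<dots> = rat_rep.rho f2 1 * Fract (q1 * q2) 1"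
      by (rule rho_rat_scale)
    also have "\<dots> = rat_rep.rho f2 1 * Fract q2 1 * Fract q1 1"
      by (simp add: mult.assoc mult.commute[of q1])
    also have "rat_rep.rho f2 1 * Fract q2 1 = rat_rep.rho f2 (Fract q2 1)"
      by (rule rho_rat_scale[symmetric])
    also have "\<dots> = rat_rep.rho (conv f2 g2) 1"
      by (simp only: rat_rep.rho_conv[OF f2 g2(5)] g2(4))
    also have "\<dots> = Fract p2 1" by (rule acts_asD(4)[OF 2(3)])
    finally show "rat_rep.rho (conv f2 (conv g1 g2)) 1 = Fract (p2 * q1) 1"
      by simp
  qed
  have "acts_as n (conv (\<lambda>w. f1 w + f2 w) (conv g1 g2)) (p1 * q2 + p2 * q1)"
    unfolding conv_add_left by (rule acts_as_add[OF s1 s2])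
  moreover have "q1 * q2 \<noteq> 0" using 1 2 by simp
  ultimately show ?case using g by blast
next
  case (smult_word c v)
  obtain g p and q :: "'k mpol" where "acts_as n g q" "q \<noteq> 0" "acts_as n (conv (word v) g) p"
    using word_right_denominator[OF smult_word] by blast
  then show ?case unfolding conv_smult_left using acts_as_smult by blast
qed

section \<open>The localization as the field of rational functions\<close>

text \<open>The map \<pi>. The chosen representative does not matter on cosets, because the ideal
  acts as zero on the field; see \<open>osi_hom_cls\<close>.\<close>

definition osi_hom :: "(gen list \<Rightarrow> 'k::field) set \<Rightarrow> 'k mpol fract" where
  "osi_hom A = rat_rep.rho (SOME f. f \<in> A) 1"

lemma osi_hom_cls:
  fixes f :: "gen list \<Rightarrow> 'k::field"
  assumes f: "f \<in> carrier (free_algebra (gens n))"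
  shows "osi_hom (cls n f) = rat_rep.rho f 1"
proof -
  have "(\<lambda>w. 0 + f w) \<in> cls n f"
    unfolding cls_eq_image using osi_ideal_zero by (rule rev_image_eqI) simp
  then have "(SOME g. g \<in> cls n f) \<in> cls n f" by (rule someI[of "\<lambda>g. g \<in> cls n f"])
  then obtain h where h: "h \<in> osi_ideal n" "(SOME g. g \<in> cls n f) = (\<lambda>w. h w + f w)"
    unfolding cls_eq_image by blast
  note fin = free_algebra_finite[OF osi_ideal_carrier[OF h(1)]] free_algebra_finite[OF f]
  show ?thesis
    unfolding osi_hom_def h(2) using rat_rep.rho_add[OF fin, of 1] rho_rat_ideal[OF h(1)] by simp
qed

text \<open>Faithfulness in the form that settles regularity: vanishing in the algebra is tested on
  polynomials.\<close>

lemma cls_eq_zero_iff: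
  fixes f :: "gen list \<Rightarrow> 'k::field"
  assumes f: "f \<in> carrier (free_algebra (gens n))"
  shows "cls n f = cls n (\<lambda>w. 0) \<longleftrightarrow> (\<forall>v. poly_rep.rho f v = 0)"
proof -
  have "f - (\<lambda>w. 0) = f" by (simp add: fun_eq_iff)
  then have "cls n f = cls n (\<lambda>w. 0) \<longleftrightarrow> f \<in> osi_ideal n"
    using cls_eq_iff[OF f zero_free_algebra_closed] by simp
  also have "\<dots> \<longleftrightarrow> (\<forall>v. poly_rep.rho f v = 0)"
    using rho_poly_ideal poly_rep_faithful[OF f] by blast
  finally show ?thesis .
qed

text \<open>The subalgebra K[x_1,...,x_n], cut out by its action. By faithfulness an element acting
  as p has the class of the corresponding polynomial in the x_i, and membership is easier to check
  on actions.\<close>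

definition poly_part :: "nat \<Rightarrow> (gen list \<Rightarrow> 'k::field) set set" where
  "poly_part n = {cls n f | f p. acts_as n f p}"

lemma osi_right_regular_fractions:
  "right_regular_fractions (osi_algebra (K :: 'k::field itself) n) osi_hom
     (\<lambda>c. Fract (Poly_Mapping.single 0 c) 1) (poly_part n)"
proof -
  let ?R = "osi_algebra K n" and ?A = "free_algebra (gens n) :: ('k, gen list \<Rightarrow> 'k) module"
  interpret ring ?R by (rule ring_osi_algebra)
  note sel = osi_algebra_simps[of K n]
  \<comment> \<open>Applying the element to the polynomial 1 returns p.\<close>
  have nonzero: "cls n f \<noteq> \<zero>\<^bsub>?R\<^esub> \<longleftrightarrow> p \<noteq> 0" if f: "acts_as n f p" for f :: "gen list \<Rightarrow> 'k" and p
  proof -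
    note a = acts_asD[OF f]
    have "(\<forall>v. p * v = 0) \<longleftrightarrow> p = 0"
    proof
      assume "\<forall>v. p * v = 0"
      from spec[OF this, of 1] show "p = 0" by simp
    qed simp
    then show ?thesis unfolding sel cls_eq_zero_iff[OF a(1)] a(3) by blast
  qed
  show ?thesis
  proof (unfold_locales)
    fix a b assume "a \<in> carrier ?R" "b \<in> carrier ?R"
    then obtain f g where f: "a = cls n f" "f \<in> carrier ?A" and g: "b = cls n g" "g \<in> carrier ?A"
      unfolding sel by blast
    note fin = free_algebra_finite[OF f(2)] free_algebra_finite[OF g(2)]
    show "osi_hom (a \<otimes>\<^bsub>?R\<^esub> b) = osi_hom a * osi_hom b"
      unfolding f g osi_algebra_mult[OF f(2) g(2)] osi_hom_cls[OF f(2)] osi_hom_cls[OF g(2)]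
        osi_hom_cls[OF conv_closed[OF f(2) g(2)]] rat_rep.rho_conv[OF fin]
      by (rule rho_rat_scale)
    show "osi_hom (a \<oplus>\<^bsub>?R\<^esub> b) = osi_hom a + osi_hom b"
      unfolding f g osi_algebra_add[OF f(2) g(2)] osi_hom_cls[OF f(2)] osi_hom_cls[OF g(2)]
        osi_hom_cls[OF add_free_algebra_closed[OF f(2) g(2)]] by (rule rat_rep.rho_add[OF fin])
  next
    have "word [] \<in> carrier ?A" by (rule word_carrier) simp
    then show "osi_hom \<one>\<^bsub>?R\<^esub> = 1"
      unfolding sel by (simp only: osi_hom_cls rat_rep.rho_word foldr.simps id_apply)
  next
    fix a c assume "a \<in> carrier ?R"
    then obtain f where f: "a = cls n f" "f \<in> carrier ?A" unfolding sel by blast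
    note cf = smult_free_algebra_closed[OF f(2), of c]
    show "c \<odot>\<^bsub>?R\<^esub> a \<in> carrier ?R"
      unfolding f(1) osi_algebra_smult[OF f(2)] sel by (rule imageI[OF cf])
    show "osi_hom (c \<odot>\<^bsub>?R\<^esub> a) = Fract (Poly_Mapping.single 0 c) 1 * osi_hom a"
      unfolding f(1) osi_algebra_smult[OF f(2)] osi_hom_cls[OF f(2)] osi_hom_cls[OF cf]
      by (rule rat_rep.rho_smult)
  next
    show "poly_part n \<subseteq> carrier ?R"
      unfolding poly_part_def sel using acts_asD(1) by blast
  next
    fix a b :: "(gen list \<Rightarrow> 'k) set" assume "a \<in> poly_part n" "b \<in> poly_part n"
    then obtain f p g q where f: "a = cls n f" "acts_as n f p" and g: "b = cls n g" "acts_as n g q"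
      unfolding poly_part_def by blast
    note f' = acts_asD[OF f(2)] and g' = acts_asD[OF g(2)]
    have fg: "acts_as n (conv f g) (p * q)" by (rule acts_as_conv[OF f(2) g(2)])
    then show "a \<otimes>\<^bsub>?R\<^esub> b \<in> poly_part n"
      unfolding f g osi_algebra_mult[OF f'(1) g'(1)] poly_part_def by blast
    have gf: "acts_as n (conv g f) (q * p)" by (rule acts_as_conv[OF g(2) f(2)])
    note fg' = acts_asD[OF fg] and gf' = acts_asD[OF gf]
    \<comment> \<open>The commutator acts by p q - q p = 0, so faithfulness puts it into the
      ideal.\<close>
    have "conv f g - conv g f \<in> osi_ideal n"
      by (rule poly_rep_faithful[OF minus_free_algebra_closed[OF fg'(1) gf'(1)]])
        (simp add: poly_rep.rho_diff[OF fg'(5) gf'(5)] fg'(3) gf'(3) mult.commute)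
    then show "a \<otimes>\<^bsub>?R\<^esub> b = b \<otimes>\<^bsub>?R\<^esub> a"
      unfolding f g osi_algebra_mult[OF f'(1) g'(1)] osi_algebra_mult[OF g'(1) f'(1)]
        cls_eq_iff[OF fg'(1) gf'(1)] .
  next
    fix a :: "(gen list \<Rightarrow> 'k) set" assume "a \<in> poly_part n" and zero: "osi_hom a = 0"
    then obtain f p where f: "a = cls n f" "acts_as n f p"
      unfolding poly_part_def by blast
    note f' = acts_asD[OF f(2)]
    have "Fract p 1 = 0" using zero unfolding f(1) osi_hom_cls[OF f'(1)] f'(4) .
    then have "p = 0" by (simp add: Zero_fract_def eq_fract)
    with nonzero[OF f(2)] show "a = \<zero>\<^bsub>?R\<^esub>" unfolding f(1) by blast
  next
    fix a :: "(gen list \<Rightarrow> 'k) set" assume "a \<in> poly_part n" and nz: "a \<noteq> \<zero>\<^bsub>?R\<^esub>"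
    then obtain f p where f: "a = cls n f" "acts_as n f p"
      unfolding poly_part_def by blast
    note f' = acts_asD[OF f(2)]
    have p: "p \<noteq> 0" using nz nonzero[OF f(2)] unfolding f(1) by blast
    show "a \<in> right_regular ?R"
    proof (rule right_regularI)
      show "a \<in> carrier ?R" unfolding f(1) sel by (rule imageI[OF f'(1)])
    next
      fix r assume "r \<in> carrier ?R" and zero: "a \<otimes>\<^bsub>?R\<^esub> r = \<zero>\<^bsub>?R\<^esub>"
      then obtain g where g: "r = cls n g" "g \<in> carrier ?A" unfolding sel by blast
      have "\<forall>v. poly_rep.rho (conv f g) v = 0"
        using zero unfolding f(1) g(1) osi_algebra_mult[OF f'(1) g(2)] sel
          cls_eq_zero_iff[OF conv_closed[OF f'(1) g(2)]] .
      \<comment> \<open>Right regularity of a comes from the polynomial ring being a domain: the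
        factor p can be cancelled for every v, which leaves g acting as zero.\<close>
      then have "\<forall>v. p * poly_rep.rho g v = 0"
        by (simp only: poly_rep.rho_conv[OF f'(5) free_algebra_finite[OF g(2)]] f'(3) simp_thms)
      then have "\<forall>v. poly_rep.rho g v = 0"
        using p no_zero_divisors by blast
      then show "r = \<zero>\<^bsub>?R\<^esub>"
        unfolding g(1) sel cls_eq_zero_iff[OF g(2)] .
    qed
  next
    fix r assume "r \<in> carrier ?R"
    then obtain f where f: "r = cls n f" "f \<in> carrier ?A" unfolding sel by blast
    obtain g p q where g: "acts_as n g q" "q \<noteq> 0" "acts_as n (conv f g) p"
      using right_denominator[OF f(2)] by blast
    have "cls n g \<in> poly_part n" unfolding poly_part_def using g(1) by blast
    moreover have "cls n g \<noteq> \<zero>\<^bsub>?R\<^esub>" using nonzero[OF g(1)] g(2) by blast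
    moreover have "r \<otimes>\<^bsub>?R\<^esub> cls n g \<in> poly_part n"
      unfolding f(1) osi_algebra_mult[OF f(2) acts_asD(1)[OF g(1)]] poly_part_def using g(3) by blast
    ultimately show "\<exists>t \<in> poly_part n. t \<noteq> \<zero>\<^bsub>?R\<^esub> \<and> r \<otimes>\<^bsub>?R\<^esub> t \<in> poly_part n" by blast
  qed
qed

section \<open>The values of fractions are the rational functions in n variables\<close>

lemma osi_hom_poly_part:
  assumes "a \<in> poly_part n"
  obtains p where "p \<in> polys_upto n" "osi_hom a = Fract p 1"
proof -
  obtain f p where f: "a = cls n f" "acts_as n f p"
    using assms unfolding poly_part_def by blast
  show ?thesis
    using that[OF acts_asD(2)[OF f(2)]] osi_hom_cls[OF acts_asD(1)[OF f(2)]] acts_asD(4)[OF f(2)] f(1) by simp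
qed

text \<open>One inclusion clears denominators in r and in s separately; the other lifts the
  numerator and the nonzero denominator of a rational function to P, where nonzero elements are
  right regular.\<close>

lemma osi_frac_values:
  "{osi_hom r / osi_hom s | r s. r \<in> carrier (osi_algebra K n) \<and> s \<in> right_regular (osi_algebra K n)}
    = carrier (ratfun_field (K :: 'k::field itself) n)" (is "?L = ?F")
proof -
  let ?R = "osi_algebra K n"
  interpret right_regular_fractions ?R osi_hom "\<lambda>c. Fract (Poly_Mapping.single 0 c) 1" "poly_part n"
    by (rule osi_right_regular_fractions)
  have F: "?F = {Fract p q | p q. p \<in> polys_upto n \<and> q \<in> polys_upto n \<and> q \<noteq> 0}"
    by (simp add: ratfun_field_def)
  \<comment> \<open>With t carrying r into P, the value of r is the value of r t divided by that of
    t, a quotient of polynomials.\<close>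
  have val: "\<exists>p q. p \<in> polys_upto n \<and> q \<in> polys_upto n \<and> q \<noteq> 0 \<and> osi_hom r = Fract p q"
    if r: "r \<in> carrier ?R" for r
  proof -
    obtain t where t: "t \<in> poly_part n" "t \<in> right_regular ?R" "t \<in> carrier ?R" "r \<otimes>\<^bsub>?R\<^esub> t \<in> poly_part n"
      by (rule denomE[OF r])
    obtain p where p: "p \<in> polys_upto n" "osi_hom (r \<otimes>\<^bsub>?R\<^esub> t) = Fract p 1"
      by (rule osi_hom_poly_part[OF t(4)])
    obtain q where q: "q \<in> polys_upto n" "osi_hom t = Fract q 1"
      by (rule osi_hom_poly_part[OF t(1)])
    have nz: "osi_hom t \<noteq> 0" by (rule hom_regular[OF t(2)])
    then have "q \<noteq> 0" unfolding q(2) by (auto simp: Zero_fract_def)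
    moreover have "osi_hom r = Fract p 1 / Fract q 1"
      using hom_mult[OF r t(3)] nz unfolding p(2) q(2)[symmetric] by simp
    ultimately show ?thesis using p(1) q(1) by auto
  qed
  show ?thesis
  proof (intro equalityI subsetI)
    fix x assume "x \<in> ?L"
    then obtain r s where rs: "r \<in> carrier ?R" "s \<in> right_regular ?R" "x = osi_hom r / osi_hom s" by blast
    obtain p q where pq: "p \<in> polys_upto n" "q \<in> polys_upto n" "q \<noteq> 0" "osi_hom r = Fract p q"
      using val[OF rs(1)] by blast
    obtain p' q' where pq': "p' \<in> polys_upto n" "q' \<in> polys_upto n" "q' \<noteq> 0" "osi_hom s = Fract p' q'"
      using val[OF reg_carrier[OF rs(2)]] by blast
    have "p' \<noteq> 0" using hom_regular[OF rs(2)] unfolding pq'(4) by (auto simp: fract_collapse)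
    then have "q * p' \<noteq> 0" using pq(3) by simp
    moreover have "x = Fract (p * q') (q * p')" unfolding rs(3) pq(4) pq'(4) by simp
    ultimately show "x \<in> ?F"
      unfolding F using polys_upto_intros(3) pq(1,2) pq'(1,2) by blast
  next
    fix x assume "x \<in> ?F"
    then obtain p q where pq: "p \<in> polys_upto n" "q \<in> polys_upto n" "q \<noteq> 0" "x = Fract p q"
      unfolding F by blast
    obtain f where f: "acts_as n f p" using acts_as_ex[OF pq(1)] by blast
    obtain g where g: "acts_as n g q" using acts_as_ex[OF pq(2)] by blast
    have v: "osi_hom (cls n f) = Fract p 1" "osi_hom (cls n g) = Fract q 1"
      using osi_hom_cls acts_asD(1,4)[OF f] acts_asD(1,4)[OF g] by metis+
    have fP: "cls n f \<in> poly_part n" and gP: "cls n g \<in> poly_part n"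
      unfolding poly_part_def using f g by blast+
    have "osi_hom (cls n g) \<noteq> 0"
      unfolding v using pq(3) by (simp add: Zero_fract_def eq_fract)
    then have "cls n g \<noteq> \<zero>\<^bsub>?R\<^esub>" using hom_zero by metis
    then have "cls n g \<in> right_regular ?R" by (rule P_regular[OF gP])
    moreover have "cls n f \<in> carrier ?R" using fP P_carrier by blast
    moreover have "x = osi_hom (cls n f) / osi_hom (cls n g)"
      unfolding v pq(4) by simp
    ultimately show "x \<in> ?L" by blast
  qed
qed

section \<open>Transport of denominator sets along the involution\<close>

lemma eta_right_regular:
  "eta ` right_regular (osi_algebra K n) = left_regular (osi_algebra K n)"
proof -
  let ?R = "osi_algebra K n"
  have swap: "a \<otimes>\<^bsub>?R\<^esub> b = \<zero>\<^bsub>?R\<^esub> \<longleftrightarrow> eta b \<otimes>\<^bsub>?R\<^esub> eta a = \<zero>\<^bsub>?R\<^esub>"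
    if ab: "a \<in> carrier ?R" "b \<in> carrier ?R" for a b
  proof -
    interpret ring ?R by (rule ring_osi_algebra)
    show ?thesis
      using eta_mult[OF ab] eta_zero[of K n] eta_eta[OF m_closed[OF ab]] by metis
  qed
  have zero: "eta a = \<zero>\<^bsub>?R\<^esub> \<longleftrightarrow> a = \<zero>\<^bsub>?R\<^esub>" if "a \<in> carrier ?R" for a
    using eta_zero[of K n] eta_eta[OF that] by metis
  show ?thesis
  proof (intro equalityI subsetI)
    fix x assume "x \<in> eta ` right_regular ?R"
    then obtain c where c: "c \<in> right_regular ?R" "x = eta c" by blast
    note cc = right_regularD(1)[OF c(1)]
    have "r = \<zero>\<^bsub>?R\<^esub>" if r: "r \<in> carrier ?R" "r \<otimes>\<^bsub>?R\<^esub> x = \<zero>\<^bsub>?R\<^esub>" for r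
    proof -
      have "c \<otimes>\<^bsub>?R\<^esub> eta r = \<zero>\<^bsub>?R\<^esub>"
        using r swap[OF r(1) eta_closed[OF cc]] eta_eta[OF cc] c(2) by simp
      from right_regularD(2)[OF c(1) eta_closed[OF r(1)] this] show ?thesis
        using zero[OF r(1)] by blast
    qed
    then show "x \<in> left_regular ?R"
      unfolding left_regular_def using eta_closed[OF cc] c(2) by blast
  next
    fix x assume x: "x \<in> left_regular ?R"
    then have xc: "x \<in> carrier ?R" unfolding left_regular_def by blast
    have "eta x \<in> right_regular ?R"
    proof (rule right_regularI)
      show "eta x \<in> carrier ?R" by (rule eta_closed[OF xc])
    next
      fix r assume r: "r \<in> carrier ?R" "eta x \<otimes>\<^bsub>?R\<^esub> r = \<zero>\<^bsub>?R\<^esub>"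
      then have "eta r \<otimes>\<^bsub>?R\<^esub> x = \<zero>\<^bsub>?R\<^esub>"
        using swap[OF eta_closed[OF xc] r(1)] eta_eta[OF xc] by simp
      then have "eta r = \<zero>\<^bsub>?R\<^esub>"
        using x eta_closed[OF r(1)] unfolding left_regular_def by blast
      then show "r = \<zero>\<^bsub>?R\<^esub>" using zero[OF r(1)] by blast
    qed
    then show "x \<in> eta ` right_regular ?R"
      using eta_eta[OF xc] by (intro image_eqI[of _ _ "eta x"]) simp_all
  qed
qed

lemma eta_right_denominator_set:
  assumes "right_denominator_set (osi_algebra K n) S"
  shows "left_denominator_set (osi_algebra K n) (eta ` S)"
proof -
  let ?R = "osi_algebra K n"
  interpret ring ?R by (rule ring_osi_algebra)
  have S: "S \<subseteq> carrier ?R" "\<one>\<^bsub>?R\<^esub> \<in> S" "\<And>s t. s \<in> S \<Longrightarrow> t \<in> S \<Longrightarrow> s \<otimes>\<^bsub>?R\<^esub> t \<in> S" "\<zero>\<^bsub>?R\<^esub> \<notin> S"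
    and ore: "\<And>r s. r \<in> carrier ?R \<Longrightarrow> s \<in> S \<Longrightarrow>
        (\<lambda>t. r \<otimes>\<^bsub>?R\<^esub> t) ` S \<inter> (\<lambda>q. s \<otimes>\<^bsub>?R\<^esub> q) ` carrier ?R \<noteq> {}"
    and ass: "\<And>r s. r \<in> carrier ?R \<Longrightarrow> s \<in> S \<Longrightarrow> s \<otimes>\<^bsub>?R\<^esub> r = \<zero>\<^bsub>?R\<^esub> \<Longrightarrow> \<exists>t \<in> S. r \<otimes>\<^bsub>?R\<^esub> t = \<zero>\<^bsub>?R\<^esub>"
    using assms unfolding right_denominator_set_def right_Ore_set_def multiplicative_set_def by blast+
  have Sc: "s \<in> carrier ?R" if "s \<in> S" for s using S(1) that by blast
  have "multiplicative_set ?R (eta ` S)"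
    unfolding multiplicative_set_def
  proof (intro conjI)
    show "eta ` S \<subseteq> carrier ?R" using Sc eta_closed by blast
    show "\<one>\<^bsub>?R\<^esub> \<in> eta ` S" using S(2) eta_one[of K n] by (metis image_eqI)
    show "\<forall>s \<in> eta ` S. \<forall>t \<in> eta ` S. s \<otimes>\<^bsub>?R\<^esub> t \<in> eta ` S"
    proof (intro ballI)
      fix s t assume "s \<in> eta ` S" "t \<in> eta ` S"
      then obtain s' t' where st: "s' \<in> S" "t' \<in> S" "s = eta s'" "t = eta t'" by blast
      have "s \<otimes>\<^bsub>?R\<^esub> t = eta (t' \<otimes>\<^bsub>?R\<^esub> s')"
        unfolding st(3,4) by (rule eta_mult[OF Sc[OF st(2)] Sc[OF st(1)], symmetric])
      then show "s \<otimes>\<^bsub>?R\<^esub> t \<in> eta ` S" using S(3)[OF st(2,1)] by blast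
    qed
    show "\<zero>\<^bsub>?R\<^esub> \<notin> eta ` S"
    proof
      assume "\<zero>\<^bsub>?R\<^esub> \<in> eta ` S"
      then obtain s where s: "s \<in> S" "\<zero>\<^bsub>?R\<^esub> = eta s" by blast
      then have "s = \<zero>\<^bsub>?R\<^esub>" using eta_eta[OF Sc[OF s(1)]] eta_zero[of K n] by simp
      with s(1) S(4) show False by simp
    qed
  qed
  moreover have "(\<lambda>t. t \<otimes>\<^bsub>?R\<^esub> r) ` eta ` S \<inter> (\<lambda>q. q \<otimes>\<^bsub>?R\<^esub> s) ` carrier ?R \<noteq> {}"
    if r: "r \<in> carrier ?R" and s: "s \<in> eta ` S" for r s
  proof -
    obtain s' where s': "s' \<in> S" "s = eta s'" using s by blast
    obtain t q where t: "t \<in> S" "q \<in> carrier ?R" "eta r \<otimes>\<^bsub>?R\<^esub> t = s' \<otimes>\<^bsub>?R\<^esub> q"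
      using ore[OF eta_closed[OF r] s'(1)] by blast
    have "eta t \<otimes>\<^bsub>?R\<^esub> r = eta (eta r \<otimes>\<^bsub>?R\<^esub> t)"
      using eta_mult[OF eta_closed[OF r] Sc[OF t(1)]] eta_eta[OF r] by simp
    also have "\<dots> = eta q \<otimes>\<^bsub>?R\<^esub> s"
      unfolding t(3) s'(2) by (rule eta_mult[OF Sc[OF s'(1)] t(2)])
    finally have "eta t \<otimes>\<^bsub>?R\<^esub> r = eta q \<otimes>\<^bsub>?R\<^esub> s" .
    then have "eta t \<otimes>\<^bsub>?R\<^esub> r \<in> (\<lambda>q. q \<otimes>\<^bsub>?R\<^esub> s) ` carrier ?R"
      using eta_closed[OF t(2)] by (rule image_eqI)
    then show ?thesis using t(1) by blast
  qed
  moreover have "\<exists>t \<in> eta ` S. t \<otimes>\<^bsub>?R\<^esub> r = \<zero>\<^bsub>?R\<^esub>"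
    if r: "r \<in> carrier ?R" and s: "s \<in> eta ` S" and rs: "r \<otimes>\<^bsub>?R\<^esub> s = \<zero>\<^bsub>?R\<^esub>" for r s
  proof -
    obtain s' where s': "s' \<in> S" "s = eta s'" using s by blast
    have "s' \<otimes>\<^bsub>?R\<^esub> eta r = eta (r \<otimes>\<^bsub>?R\<^esub> s)"
      unfolding s'(2) using eta_mult[OF r eta_closed[OF Sc[OF s'(1)]]] eta_eta[OF Sc[OF s'(1)]] by simp
    then have "s' \<otimes>\<^bsub>?R\<^esub> eta r = \<zero>\<^bsub>?R\<^esub>" unfolding rs using eta_zero[of K n] by simp
    then obtain t where t: "t \<in> S" "eta r \<otimes>\<^bsub>?R\<^esub> t = \<zero>\<^bsub>?R\<^esub>"
      using ass[OF eta_closed[OF r] s'(1)] by blast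
    have "eta t \<otimes>\<^bsub>?R\<^esub> r = eta (eta r \<otimes>\<^bsub>?R\<^esub> t)"
      using eta_mult[OF eta_closed[OF r] Sc[OF t(1)]] eta_eta[OF r] by simp
    then have "eta t \<otimes>\<^bsub>?R\<^esub> r = \<zero>\<^bsub>?R\<^esub>" unfolding t(2) using eta_zero[of K n] by simp
    with t(1) show ?thesis by blast
  qed
  ultimately show ?thesis
    unfolding left_denominator_set_def left_Ore_set_def by blast
qed

text \<open>The image of the right regular elements under \<eta> is the set of all left regular
  ones. Being a left denominator set, it is the largest one, and a second application of \<eta>
  returns to the start.\<close>

lemma eta_denom_eq:
  assumes "right_denominator_set (osi_algebra K n) (right_regular (osi_algebra K n))"
  shows "eta_denom K n = right_regular (osi_algebra K n)"
proof -
  let ?R = "osi_algebra K n"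
  have "left_denominator_set ?R (left_regular ?R)"
    using eta_right_denominator_set[OF assms] unfolding eta_right_regular .
  then have "eta_denom K n = eta ` left_regular ?R"
    unfolding eta_denom_def by (simp only: largest_left_regular_denom_eq)
  also have "\<dots> = (\<lambda>a. eta (eta a)) ` right_regular ?R"
    unfolding eta_right_regular[symmetric] image_image ..
  also have "\<dots> = (\<lambda>a. a) ` right_regular ?R"
    by (rule image_cong[OF refl eta_eta[OF right_regularD(1)]])
  finally show ?thesis by simp
qed

lemma algebra_isomorphic_refl: "A \<simeq>\<^sub>a A"
proof -
  have "id \<in> algebra_iso A A"
    by (simp add: algebra_iso_def ring_iso_def ring_hom_def)
  then show ?thesis unfolding algebra_isomorphic_def by blast
qed

text \<open>The identification of the transported ring with K(x_1,...,x_n) is rendered by an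
  isomorphism that sends the fraction x_i / 1 to the variable x_i, which says more than a bare
  isomorphism.\<close>

theorem corollary3p15:
  fixes K :: "'k::field itself" and n :: nat
  assumes "n \<ge> 1"
  shows
    "(right_regular_quotient_ring (osi_algebra K n) \<simeq>\<^sub>a eta_left_regular_quotient_ring K n \<and>
     (\<exists>h \<in> algebra_iso (eta_left_regular_quotient_ring K n) (ratfun_field K n).
        \<forall>i \<in> {1..n}.
          h (right_frac (osi_algebra K n) (eta_denom K n) (osi_gen K n (X i)) \<one>\<^bsub>osi_algebra K n\<^esub>)
            = ratfun_var K i)) \<and>
     (right_regular (osi_algebra K n) = largest_right_regular_denom (osi_algebra K n) \<and>
     right_denominator_set (osi_algebra K n) (right_regular (osi_algebra K n)) \<and>
     classical_right_regular_quotient_ring (osi_algebra K n)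
       = right_regular_quotient_ring (osi_algebra K n) \<and>
     right_regular_quotient_ring (osi_algebra K n) \<simeq>\<^sub>a ratfun_field K n)"
proof -
  let ?R = "osi_algebra K n"
  interpret right_regular_fractions ?R osi_hom "\<lambda>c. Fract (Poly_Mapping.single 0 c) 1" "poly_part n"
    by (rule osi_right_regular_fractions)
  have denom: "right_denominator_set ?R (right_regular ?R)" by (rule right_denominator_regular)
  note largest = largest_right_regular_denom_eq[OF denom] and eta = eta_denom_eq[OF denom]
  have "carrier (ratfun_field K n) = frac_values"
    unfolding frac_values_def osi_frac_values ..
  then obtain h where h: "h \<in> algebra_iso (right_localization ?R (right_regular ?R)) (ratfun_field K n)"
    and val: "\<forall>r \<in> carrier ?R. \<forall>s \<in> right_regular ?R.
        h (right_frac ?R (right_regular ?R) r s) = osi_hom r / osi_hom s"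
    using right_localization_iso[of "ratfun_field K n"] by (auto simp: ratfun_field_def)
  have var: "h (right_frac ?R (right_regular ?R) (osi_gen K n (X i)) \<one>\<^bsub>?R\<^esub>) = ratfun_var K i"
    if i: "i \<in> {1..n}" for i
  proof -
    have "X i \<in> gens n" using i by (simp add: gens_def)
    then have w: "word [X i] \<in> carrier (free_algebra (gens n) :: ('k, gen list \<Rightarrow> 'k) module)"
      by (intro word_carrier) simp
    then have "osi_gen K n (X i) \<in> carrier ?R"
      unfolding osi_algebra_simps by (rule imageI)
    then have "h (right_frac ?R (right_regular ?R) (osi_gen K n (X i)) \<one>\<^bsub>?R\<^esub>) = osi_hom (osi_gen K n (X i)) / 1"
      using val S_one hom_one by metis
    also have "\<dots> = ratfun_var K i"
      unfolding osi_algebra_simps osi_hom_cls[OF w] by (simp add: rat_rep.rho_word ratfun_var_def)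
    finally show ?thesis .
  qed
  have "right_regular_quotient_ring ?R \<simeq>\<^sub>a ratfun_field K n"
    unfolding algebra_isomorphic_def right_regular_quotient_ring_def largest using h by blast
  \<comment> \<open>All three quotient rings unfold to one and the same localization, so the first
    isomorphism is the identity and the equality with the classical ring is literal.\<close>
  then show ?thesis
    unfolding right_regular_quotient_ring_def eta_left_regular_quotient_ring_def
      classical_right_regular_quotient_ring_def largest eta
    using denom h var algebra_isomorphic_refl by blast
qed

end
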